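(* Let $M$ be an oriented manifold of dimension $2n+1$ and $X$ a non-vanishing vector field on $M$. Then $X$ is a Beltrami field for some Riemannian metric $g$ on $M$ if and only if there is a one-form $\alpha$ on $M$ such that $\alpha(X)>0$ and $\iota_X(d\alpha)^n=0$. If furthermore $X$ preserves a volume form $\mu$, then one can construct such a metric $g$ (for which $X$ is Beltrami) with Riemannian volume form $\mu$.
   Context: Everything is smooth. On a Riemannian manifold $(M,g)$ of dimension $2n+1$ with Riemannian volume form $\mu$, the curl of a vector field $X$ is the unique vector field $Y$ with $\iota_Y\mu=(d\alpha)^n$, where $\alpha=g(X,\cdot)$. $X$ is Beltrami for $g$ if $Y=fX$ for some $f\in C^\infty(M)$. *)

theory Defs
  imports "HOL-Analysis.Analysis"
begin

primrec higher_differentiable_on ::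
  "nat \<Rightarrow> 'a::real_normed_vector set \<Rightarrow> ('a \<Rightarrow> 'b::real_normed_vector) \<Rightarrow> bool" where
  "higher_differentiable_on 0 S f \<longleftrightarrow> continuous_on S f"
| "higher_differentiable_on (Suc k) S f \<longleftrightarrow>
     (\<forall>x\<in>S. f differentiable (at x)) \<and>
     (\<forall>v. higher_differentiable_on k S (\<lambda>x. frechet_derivative f (at x) v))"

text \<open>Only used for open \<open>S\<close>.\<close>

definition smooth_on ::
  "'a::real_normed_vector set \<Rightarrow> ('a \<Rightarrow> 'b::real_normed_vector) \<Rightarrow> bool" where
  "smooth_on S f \<longleftrightarrow> (\<forall>k. higher_differentiable_on k S f)"

text \<open>
  The manifold is the whole type \<open>'a\<close>, assumed Hausdorff and second countable through its type
  class.  It is modelled on \<open>real ^ 'n\<close>.  A chart is a pair of its domain and its coordinate map,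
  whose values outside the domain are irrelevant.
\<close>

type_synonym ('a, 'n) chart = "'a set \<times> ('a \<Rightarrow> real ^ 'n)"

definition chart_inv :: "('a, 'n) chart \<Rightarrow> real ^ 'n \<Rightarrow> 'a" where
  "chart_inv c = inv_into (fst c) (snd c)"

definition chart_image :: "('a, 'n) chart \<Rightarrow> (real ^ 'n) set" where
  "chart_image c = snd c ` fst c"

definition is_chart :: "('a::topological_space, 'n::finite) chart \<Rightarrow> bool" where
  "is_chart c \<longleftrightarrow> open (fst c) \<and> open (chart_image c) \<and>
     homeomorphism (fst c) (chart_image c) (snd c) (chart_inv c)"

definition transition ::
  "('a, 'n) chart \<Rightarrow> ('a, 'n) chart \<Rightarrow> real ^ 'n \<Rightarrow> real ^ 'n" where
  "transition c d = snd d \<circ> chart_inv c"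

definition smooth_atlas ::
  "('a::{t2_space, second_countable_topology}, 'n::finite) chart set \<Rightarrow> bool" where
  "smooth_atlas A \<longleftrightarrow> (\<forall>c\<in>A. is_chart c) \<and> (\<Union>c\<in>A. fst c) = UNIV \<and>
     (\<forall>c\<in>A. \<forall>d\<in>A. smooth_on (snd c ` (fst c \<inter> fst d)) (transition c d))"

definition oriented_atlas ::
  "('a::{t2_space, second_countable_topology}, 'n::finite) chart set \<Rightarrow> bool" where
  "oriented_atlas A \<longleftrightarrow> smooth_atlas A \<and>
     (\<forall>c\<in>A. \<forall>d\<in>A. \<forall>p\<in>fst c \<inter> fst d.
        det (matrix (frechet_derivative (transition c d) (at (snd c p)))) > 0)"

text \<open>
  The tangent space at every point \<open>p\<close> is a copy of \<open>real ^ 'n\<close>: a vector is represented by its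
  components in a chart \<open>chart_at A p\<close> around \<open>p\<close>, chosen once and for all.  The maps
  \<open>to_chart\<close> and \<open>from_chart\<close> convert between these components and those in another
  chart \<open>c\<close> around \<open>p\<close>.  Since \<open>chart_at A\<close> jumps from point to point, smoothness of a field
  always refers to its components in a fixed chart.
\<close>

definition chart_at :: "('a, 'n) chart set \<Rightarrow> 'a \<Rightarrow> ('a, 'n) chart" where
  "chart_at A p = (SOME c. c \<in> A \<and> p \<in> fst c)"

definition to_chart ::
  "('a, 'n::finite) chart set \<Rightarrow> ('a, 'n) chart \<Rightarrow> 'a \<Rightarrow> real ^ 'n \<Rightarrow> real ^ 'n" where
  "to_chart A c p =
     frechet_derivative (transition (chart_at A p) c) (at (snd (chart_at A p) p))"

definition from_chart ::
  "('a, 'n::finite) chart set \<Rightarrow> ('a, 'n) chart \<Rightarrow> 'a \<Rightarrow> real ^ 'n \<Rightarrow> real ^ 'n" where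
  "from_chart A c p = frechet_derivative (transition c (chart_at A p)) (at (snd c p))"

definition smooth_function :: "('a, 'n::finite) chart set \<Rightarrow> ('a \<Rightarrow> real) \<Rightarrow> bool" where
  "smooth_function A f \<longleftrightarrow> (\<forall>c\<in>A. smooth_on (chart_image c) (f \<circ> chart_inv c))"

definition local_vector_field ::
  "('a, 'n::finite) chart set \<Rightarrow> ('a, 'n) chart \<Rightarrow> ('a \<Rightarrow> real ^ 'n) \<Rightarrow> real ^ 'n \<Rightarrow> real ^ 'n" where
  "local_vector_field A c X x = to_chart A c (chart_inv c x) (X (chart_inv c x))"

definition vector_field :: "('a, 'n::finite) chart set \<Rightarrow> ('a \<Rightarrow> real ^ 'n) \<Rightarrow> bool" where
  "vector_field A X \<longleftrightarrow> (\<forall>c\<in>A. smooth_on (chart_image c) (local_vector_field A c X))"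

text \<open>
  An alternating \<open>k\<close>-linear form takes its arguments as a sequence of vectors, of which only the
  first \<open>k\<close> entries matter; two such forms are equal iff they are equal as functions.
\<close>

type_synonym 'n alt_form = "(nat \<Rightarrow> real ^ 'n) \<Rightarrow> real"

definition alternating_form :: "nat \<Rightarrow> 'n::finite alt_form \<Rightarrow> bool" where
  "alternating_form k \<omega> \<longleftrightarrow>
     (\<forall>v w. (\<forall>i<k. v i = w i) \<longrightarrow> \<omega> v = \<omega> w) \<and>
     (\<forall>v. \<forall>i<k. linear (\<lambda>u. \<omega> (v(i := u)))) \<and>
     (\<forall>v. \<forall>i<k. \<forall>j<k. i \<noteq> j \<and> v i = v j \<longrightarrow> \<omega> v = 0)"

text \<open>The degree is passed explicitly because the contraction of a \<open>0\<close>-form is zero.\<close>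

definition contract :: "nat \<Rightarrow> real ^ 'n \<Rightarrow> 'n alt_form \<Rightarrow> 'n alt_form" where
  "contract k u \<omega> = (\<lambda>v. if k = 0 then 0 else \<omega> (case_nat u v))"

definition wedge :: "nat \<Rightarrow> nat \<Rightarrow> 'n alt_form \<Rightarrow> 'n alt_form \<Rightarrow> 'n alt_form" where
  "wedge k l \<omega> \<eta> = (\<lambda>v.
     (\<Sum>\<sigma> | \<sigma> permutes {..<k + l}.
        of_int (sign \<sigma>) * \<omega> (\<lambda>i. v (\<sigma> i)) * \<eta> (\<lambda>i. v (\<sigma> (k + i)))) / (fact k * fact l))"

primrec wedge_power :: "nat \<Rightarrow> 'n alt_form \<Rightarrow> nat \<Rightarrow> 'n alt_form" where
  "wedge_power k \<omega> 0 = (\<lambda>v. 1)"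
| "wedge_power k \<omega> (Suc m) = wedge k (k * m) \<omega> (wedge_power k \<omega> m)"

text \<open>
  The linear order on \<open>'n\<close> only serves to number the coordinates: \<open>card {..<i}\<close> is the rank
  of \<open>i\<close>, so the matrix below has the vectors \<open>v 0, v 1, \<dots>\<close> as its rows, in this order.
  Positivity of a frame refers to the chart \<open>chart_at A p\<close>, hence for an oriented atlas to the
  orientation.
\<close>

definition positive_frame :: "(nat \<Rightarrow> real ^ 'n::{finite, linorder}) \<Rightarrow> bool" where
  "positive_frame v \<longleftrightarrow> det (\<chi> i. v (card {..<i})) > 0"

definition local_form ::
  "('a, 'n::finite) chart set \<Rightarrow> ('a, 'n) chart \<Rightarrow> ('a \<Rightarrow> 'n alt_form) \<Rightarrow> real ^ 'n \<Rightarrow> 'n alt_form" where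
  "local_form A c \<omega> x v = \<omega> (chart_inv c x) (\<lambda>i. from_chart A c (chart_inv c x) (v i))"

definition diff_form ::
  "('a, 'n::finite) chart set \<Rightarrow> nat \<Rightarrow> ('a \<Rightarrow> 'n alt_form) \<Rightarrow> bool" where
  "diff_form A k \<omega> \<longleftrightarrow> (\<forall>p. alternating_form k (\<omega> p)) \<and>
     (\<forall>c\<in>A. \<forall>v. smooth_on (chart_image c) (\<lambda>x. local_form A c \<omega> x v))"

text \<open>
  \<open>(d\<omega>)(v\<^sub>0, \<dots>, v\<^sub>k) = (\<Sum>i\<le>k. (-1)\<^sup>i D\<omega>(v\<^sub>i)(v\<^sub>0, \<dots>, v\<^sub>i\<^sub>-\<^sub>1, v\<^sub>i\<^sub>+\<^sub>1, \<dots>, v\<^sub>k))\<close> in a chart.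
\<close>

definition flat_ext_deriv :: "nat \<Rightarrow> (real ^ 'n \<Rightarrow> 'n::finite alt_form) \<Rightarrow> real ^ 'n \<Rightarrow> 'n alt_form" where
  "flat_ext_deriv k \<omega> x = (\<lambda>v. \<Sum>i\<le>k. (-1) ^ i *
     frechet_derivative (\<lambda>y. \<omega> y (\<lambda>j. if j < i then v j else v (Suc j))) (at x) (v i))"

definition ext_deriv ::
  "('a, 'n::finite) chart set \<Rightarrow> nat \<Rightarrow> ('a \<Rightarrow> 'n alt_form) \<Rightarrow> 'a \<Rightarrow> 'n alt_form" where
  "ext_deriv A k \<omega> p =
     flat_ext_deriv k (local_form A (chart_at A p) \<omega>) (snd (chart_at A p) p)"

text \<open>
  \<open>(L\<^sub>X\<omega>)(v\<^sub>1, \<dots>, v\<^sub>k) = D\<omega>(X)(v\<^sub>1, \<dots>, v\<^sub>k) + (\<Sum>i. \<omega>(v\<^sub>1, \<dots>, DX(v\<^sub>i), \<dots>, v\<^sub>k))\<close> in a chart.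
\<close>

definition flat_lie_deriv ::
  "nat \<Rightarrow> (real ^ 'n \<Rightarrow> real ^ 'n) \<Rightarrow> (real ^ 'n \<Rightarrow> 'n::finite alt_form) \<Rightarrow> real ^ 'n \<Rightarrow> 'n alt_form" where
  "flat_lie_deriv k X \<omega> x = (\<lambda>v.
     frechet_derivative (\<lambda>y. \<omega> y v) (at x) (X x) +
     (\<Sum>i<k. \<omega> x (v(i := frechet_derivative X (at x) (v i)))))"

definition lie_deriv ::
  "('a, 'n::finite) chart set \<Rightarrow> nat \<Rightarrow> ('a \<Rightarrow> real ^ 'n) \<Rightarrow> ('a \<Rightarrow> 'n alt_form) \<Rightarrow> 'a \<Rightarrow> 'n alt_form" where
  "lie_deriv A k X \<omega> p =
     flat_lie_deriv k (local_vector_field A (chart_at A p) X) (local_form A (chart_at A p) \<omega>)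
       (snd (chart_at A p) p)"

text \<open>On an oriented manifold, volume forms are required to be compatible with the orientation.\<close>

definition volume_form ::
  "('a, 'n::{finite, linorder}) chart set \<Rightarrow> ('a \<Rightarrow> 'n alt_form) \<Rightarrow> bool" where
  "volume_form A \<mu> \<longleftrightarrow> diff_form A CARD('n) \<mu> \<and> (\<forall>p v. positive_frame v \<longrightarrow> \<mu> p v > 0)"

definition preserves_volume ::
  "('a, 'n::finite) chart set \<Rightarrow> ('a \<Rightarrow> real ^ 'n) \<Rightarrow> ('a \<Rightarrow> 'n alt_form) \<Rightarrow> bool" where
  "preserves_volume A X \<mu> \<longleftrightarrow> (\<forall>p v. lie_deriv A CARD('n) X \<mu> p v = 0)"

definition riemannian_metric ::
  "('a, 'n::finite) chart set \<Rightarrow> ('a \<Rightarrow> real ^ 'n \<Rightarrow> real ^ 'n \<Rightarrow> real) \<Rightarrow> bool" where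
  "riemannian_metric A g \<longleftrightarrow>
     (\<forall>p. bilinear (g p) \<and> (\<forall>u v. g p u v = g p v u) \<and> (\<forall>u. u \<noteq> 0 \<longrightarrow> g p u u > 0)) \<and>
     (\<forall>c\<in>A. \<forall>u v. smooth_on (chart_image c)
        (\<lambda>x. g (chart_inv c x) (from_chart A c (chart_inv c x) u) (from_chart A c (chart_inv c x) v)))"

definition orthonormal_frame ::
  "(real ^ 'n \<Rightarrow> real ^ 'n \<Rightarrow> real) \<Rightarrow> (nat \<Rightarrow> real ^ 'n::finite) \<Rightarrow> bool" where
  "orthonormal_frame h v \<longleftrightarrow>
     (\<forall>i<CARD('n). \<forall>j<CARD('n). h (v i) (v j) = (if i = j then 1 else 0))"

text \<open>
  The Riemannian volume form is the unique top-degree form with value 1 on all positively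
  oriented orthonormal frames.
\<close>

definition riemannian_volume_form ::
  "('a, 'n::{finite, linorder}) chart set \<Rightarrow> ('a \<Rightarrow> real ^ 'n::{finite, linorder} \<Rightarrow> real ^ 'n::{finite, linorder} \<Rightarrow> real) \<Rightarrow>
   ('a \<Rightarrow> 'n alt_form) \<Rightarrow> bool" where
  "riemannian_volume_form A g \<mu> \<longleftrightarrow> diff_form A CARD('n) \<mu> \<and>
     (\<forall>p v. orthonormal_frame (g p) v \<and> positive_frame v \<longrightarrow> \<mu> p v = 1)"

definition metric_dual ::
  "('a \<Rightarrow> real ^ 'n \<Rightarrow> real ^ 'n \<Rightarrow> real) \<Rightarrow> ('a \<Rightarrow> real ^ 'n) \<Rightarrow> 'a \<Rightarrow> 'n alt_form" where
  "metric_dual g X p = (\<lambda>v. g p (X p) (v 0))"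

text \<open>
  The manifold has dimension \<open>CARD('n) = 2 * n + 1\<close>.  The curl is the unique \<open>Y\<close> related to
  \<open>X\<close> in this way, since contraction into a volume form is injective.
\<close>

definition is_curl ::
  "('a, 'n::{finite, linorder}) chart set \<Rightarrow> nat \<Rightarrow> ('a \<Rightarrow> real ^ 'n::{finite, linorder} \<Rightarrow> real ^ 'n::{finite, linorder} \<Rightarrow> real) \<Rightarrow>
   ('a \<Rightarrow> real ^ 'n::{finite, linorder}) \<Rightarrow> ('a \<Rightarrow> real ^ 'n::{finite, linorder}) \<Rightarrow> bool" where
  "is_curl A n g X Y \<longleftrightarrow> vector_field A Y \<and>
     (\<exists>\<mu>. riemannian_volume_form A g \<mu> \<and>
       (\<forall>p. contract (2 * n + 1) (Y p) (\<mu> p) =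
             wedge_power 2 (ext_deriv A 1 (metric_dual g X) p) n))"

definition beltrami ::
  "('a, 'n::{finite, linorder}) chart set \<Rightarrow> nat \<Rightarrow> ('a \<Rightarrow> real ^ 'n::{finite, linorder} \<Rightarrow> real ^ 'n::{finite, linorder} \<Rightarrow> real) \<Rightarrow>
   ('a \<Rightarrow> real ^ 'n::{finite, linorder}) \<Rightarrow> bool" where
  "beltrami A n g X \<longleftrightarrow> vector_field A X \<and>
     (\<exists>Y f. is_curl A n g X Y \<and> smooth_function A f \<and> (\<forall>p. Y p = f p *\<^sub>R X p))"

definition adapted_one_form ::
  "('a, 'n::finite) chart set \<Rightarrow> nat \<Rightarrow> ('a \<Rightarrow> real ^ 'n) \<Rightarrow> ('a \<Rightarrow> 'n alt_form) \<Rightarrow> bool" where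
  "adapted_one_form A n X \<alpha> \<longleftrightarrow> diff_form A 1 \<alpha> \<and>
     (\<forall>p. \<alpha> p (\<lambda>_. X p) > 0) \<and>
     (\<forall>p v. contract (2 * n) (X p) (wedge_power 2 (ext_deriv A 1 \<alpha> p) n) v = 0)"

end

(*
  If X is Beltrami for g, then alpha = g(X, .) satisfies alpha(X) > 0, and contracting
  (d alpha)^n = mu(f X, .) with X gives zero.

  Conversely, let mu be a volume form and h an arbitrary metric, and let pi be the projection onto
  ker alpha along X. The metric
    g(u, v) = alpha(u) alpha(v) / alpha(X) + s h(pi u, pi v)
  has g(X, .) = alpha for every function s > 0. Its Gram determinant is s^(2n) times the one for
  s = 1, so its volume form is mu for a suitable s (unless n = 0, where every field is Beltrami).
  As X annihilates (d alpha)^n, contracting the top-degree form alpha /\ (d alpha)^n = F mu with X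
  gives alpha(X) (d alpha)^n = F mu(X, .), so the curl of X is (F / alpha(X)) X.
*)

theory Submission
  imports Defs
begin

section \<open>Smooth maps\<close>

text \<open>The metric and the volume form that the argument starts from are both built from a
  locally finite family of bump functions. Sums of inner products weighted by it give
  \<open>h\<close>; the weights need not add up to 1, since positive definite forms are closed under
  addition and positive scaling. The square root of the Gram determinant of \<open>h\<close> then
  gives a volume form: all Jacobians are positive, so the root transforms like a top-degree form.
  The obstacle is the encoding of tangent vectors at p by components in \<open>chart_at A p\<close>,
  which jumps with p. Smoothness is always verified for components in a fixed chart, and since the
  exterior derivative is computed at each point in that point's own chart, its independence of the
  chart has to be proved; this rests on the symmetry of second derivatives. The factor s^(2n) is the
  squared determinant of the map that fixes X and multiplies ker \<alpha> by sqrt s. It forces s to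
  be a 2n-th root, hence the smoothness of real powers. For n = 0 the factor s has no effect on
  volume, and the square of \<mu> itself serves as the metric.\<close>

lemma frechet_derivative_worksI:
  "f differentiable net \<Longrightarrow> (f has_derivative frechet_derivative f net) net"
  by (simp add: frechet_derivative_works)

text \<open>Derivatives at a point depend on values nearby, so openness of \<open>S\<close> is what
  carries equality on \<open>S\<close> over to the derivatives.\<close>

lemma higher_differentiable_on_cong:
  assumes "open S" "\<And>x. x \<in> S \<Longrightarrow> f x = g x" "higher_differentiable_on k S f"
  shows "higher_differentiable_on k S g"
  using assms
proof (induction k arbitrary: f g)
  case 0
  then show ?case by (metis continuous_on_cong higher_differentiable_on.simps(1))
next
  case (Suc k)
  have f: "\<forall>x\<in>S. f differentiable (at x)"
    "\<And>v. higher_differentiable_on k S (\<lambda>x. frechet_derivative f (at x) v)"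
    using Suc.prems(3) by simp_all
  have D: "(g has_derivative frechet_derivative f (at x)) (at x)" if "x \<in> S" for x
    by (rule has_derivative_transform_within_open[OF frechet_derivative_worksI Suc.prems(1) that Suc.prems(2)])
      (use f(1) that in auto)
  have eq: "frechet_derivative f (at x) = frechet_derivative g (at x)" if "x \<in> S" for x
    using frechet_derivative_at[OF D[OF that]] .
  have "higher_differentiable_on k S (\<lambda>x. frechet_derivative g (at x) v)" for v
    by (rule Suc.IH[OF Suc.prems(1) _ f(2)]) (simp add: eq)
  then show ?case
    using D differentiableI by (metis higher_differentiable_on.simps(2))
qed

lemma higher_differentiable_on_mono:
  assumes "higher_differentiable_on k S f" "T \<subseteq> S"
  shows "higher_differentiable_on k T f"
  using assms(1)
proof (induction k arbitrary: f)
  case 0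
  then show ?case using assms(2) continuous_on_subset by auto
next
  case (Suc k)
  then show ?case using assms(2) by (simp add: subset_iff)
qed

lemma higher_differentiable_on_local:
  assumes "open S" "\<And>x. x \<in> S \<Longrightarrow> \<exists>U. open U \<and> x \<in> U \<and> higher_differentiable_on k U f"
  shows "higher_differentiable_on k S f"
  using assms
proof (induction k arbitrary: f)
  case 0
  then have "isCont f x" if "x \<in> S" for x
    using that continuous_on_eq_continuous_at by (metis higher_differentiable_on.simps(1))
  then show ?case by (simp add: continuous_at_imp_continuous_on)
next
  case (Suc k)
  show ?case
    unfolding higher_differentiable_on.simps
  proof (intro conjI allI ballI)
    fix x assume "x \<in> S"
    then show "f differentiable (at x)" using Suc.prems(2)[of x] by auto
  next
    fix v
    have "\<exists>U. open U \<and> x \<in> U \<and> higher_differentiable_on k U (\<lambda>x. frechet_derivative f (at x) v)"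
      if "x \<in> S" for x
      using Suc.prems(2)[OF that] by auto
    then show "higher_differentiable_on k S (\<lambda>x. frechet_derivative f (at x) v)"
      using Suc.IH Suc.prems(1) by blast
  qed
qed

text \<open>Supplies the undifferentiated factors in the product and chain rules with the regularity
  that the induction hypothesis asks for.\<close>

lemma higher_differentiable_on_SucD:
  "higher_differentiable_on (Suc k) S f \<Longrightarrow> higher_differentiable_on k S f"
proof (induction k arbitrary: f)
  case 0
  then have "isCont f x" if "x \<in> S" for x
    using that differentiable_imp_continuous_within by auto
  then show ?case by (simp add: continuous_at_imp_continuous_on)
next
  case (Suc k)
  from Suc.prems show ?case
    unfolding higher_differentiable_on.simps(2)[of "Suc k"] higher_differentiable_on.simps(2)[of k S f]
    using Suc.IH by blast
qed

lemma higher_differentiable_on_const: "higher_differentiable_on k S (\<lambda>x. c)"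
  by (induction k arbitrary: c) auto

lemma higher_differentiable_on_add:
  assumes "open S" "higher_differentiable_on k S f" "higher_differentiable_on k S g"
  shows "higher_differentiable_on k S (\<lambda>x. f x + g x)"
  using assms
proof (induction k arbitrary: f g)
  case 0
  then show ?case by (simp add: continuous_on_add)
next
  case (Suc k)
  have "higher_differentiable_on k S (\<lambda>x. frechet_derivative (\<lambda>x. f x + g x) (at x) v)" for v
  proof (rule higher_differentiable_on_cong[OF \<open>open S\<close>])
    show "higher_differentiable_on k S
        (\<lambda>x. frechet_derivative f (at x) v + frechet_derivative g (at x) v)"
      using Suc by simp
    show "frechet_derivative f (at x) v + frechet_derivative g (at x) v =
        frechet_derivative (\<lambda>x. f x + g x) (at x) v" if "x \<in> S" for x
    proof -
      have "((\<lambda>x. f x + g x) has_derivative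
          (\<lambda>v. frechet_derivative f (at x) v + frechet_derivative g (at x) v)) (at x)"
        using Suc.prems that by (auto intro!: has_derivative_add simp: frechet_derivative_works)
      from frechet_derivative_at[OF this] show ?thesis by metis
    qed
  qed
  then show ?case using Suc.prems by simp
qed

text \<open>The product rule yields two terms of the same shape, so the induction runs over all
  pairs \<open>f\<close>, \<open>g\<close>. A general \<open>B\<close> covers products, scalar
  multiples and inner products at once.\<close>

lemma higher_differentiable_on_bilinear:
  assumes "bounded_bilinear B" "open S"
    and "higher_differentiable_on k S f" "higher_differentiable_on k S g"
  shows "higher_differentiable_on k S (\<lambda>x. B (f x) (g x))"
  using assms(3,4)
proof (induction k arbitrary: f g)
  case 0
  then show ?case using bounded_bilinear.continuous_on[OF assms(1)] by auto
next
  case (Suc k)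
  have D: "((\<lambda>x. B (f x) (g x)) has_derivative
      (\<lambda>v. B (f x) (frechet_derivative g (at x) v) + B (frechet_derivative f (at x) v) (g x))) (at x)"
    if "x \<in> S" for x
    using Suc.prems that
    by (auto intro!: bounded_bilinear.FDERIV[OF assms(1)] simp: frechet_derivative_works)
  have "higher_differentiable_on k S (\<lambda>x. frechet_derivative (\<lambda>x. B (f x) (g x)) (at x) v)" for v
  proof (rule higher_differentiable_on_cong[OF \<open>open S\<close>])
    show "higher_differentiable_on k S
        (\<lambda>x. B (f x) (frechet_derivative g (at x) v) + B (frechet_derivative f (at x) v) (g x))"
      using Suc.prems higher_differentiable_on_SucD[of k S f] higher_differentiable_on_SucD[of k S g]
      by (auto intro!: higher_differentiable_on_add \<open>open S\<close> Suc.IH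
          simp del: higher_differentiable_on.simps, simp_all)
    show "B (f x) (frechet_derivative g (at x) v) + B (frechet_derivative f (at x) v) (g x) =
        frechet_derivative (\<lambda>x. B (f x) (g x)) (at x) v" if "x \<in> S" for x
      using frechet_derivative_at[OF D[OF that]] by metis
  qed
  then show ?case using D by (auto simp: differentiable_def)
qed

text \<open>Only compositions with an outer function of one real variable are needed.\<close>

lemma higher_differentiable_on_compose:
  fixes h :: "real \<Rightarrow> 'b::real_normed_vector"
  assumes "open S" "open T" "\<And>x. x \<in> S \<Longrightarrow> f x \<in> T"
    and "higher_differentiable_on k S f" "higher_differentiable_on k T h"
  shows "higher_differentiable_on k S (\<lambda>x. h (f x))"
  using assms(4,5)
proof (induction k arbitrary: h)
  case 0
  then show ?case using continuous_on_compose2 assms(3)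
    by (metis higher_differentiable_on.simps(1) image_subsetI)
next
  case (Suc k)
  have D: "((\<lambda>x. h (f x)) has_derivative
      (\<lambda>v. frechet_derivative f (at x) v *\<^sub>R frechet_derivative h (at (f x)) 1)) (at x)"
    if "x \<in> S" for x
  proof -
    have h: "(h has_derivative frechet_derivative h (at (f x))) (at (f x))"
      using Suc.prems assms(3) that by (auto simp: frechet_derivative_works)
    have f: "(f has_derivative frechet_derivative f (at x)) (at x)"
      using Suc.prems(1) that by (auto intro: frechet_derivative_worksI)
    \<comment> \<open>A linear map on the reals is determined by its value at 1. This turns the
      chain rule into a product of the derivative of \<open>f\<close> with another composition with
      \<open>f\<close>, to which the induction hypothesis applies.\<close>
    have "frechet_derivative h (at (f x)) \<circ> frechet_derivative f (at x) =
        (\<lambda>v. frechet_derivative f (at x) v *\<^sub>R frechet_derivative h (at (f x)) 1)"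
    proof
      fix v
      show "(frechet_derivative h (at (f x)) \<circ> frechet_derivative f (at x)) v =
          frechet_derivative f (at x) v *\<^sub>R frechet_derivative h (at (f x)) 1"
        using linear_scale[OF has_derivative_linear[OF h], of "frechet_derivative f (at x) v" 1] by simp
    qed
    with diff_chain_at[OF f h] show ?thesis unfolding o_def by simp
  qed
  have "higher_differentiable_on k S (\<lambda>x. frechet_derivative (\<lambda>x. h (f x)) (at x) v)" for v
  proof (rule higher_differentiable_on_cong[OF \<open>open S\<close>])
    show "higher_differentiable_on k S
        (\<lambda>x. frechet_derivative f (at x) v *\<^sub>R frechet_derivative h (at (f x)) 1)"
      using Suc.prems higher_differentiable_on_SucD[OF Suc.prems(1)]
      by (intro higher_differentiable_on_bilinear[OF bounded_bilinear_scaleR \<open>open S\<close>] Suc.IH[of "\<lambda>y. frechet_derivative h (at y) 1"]) auto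
    show "frechet_derivative f (at x) v *\<^sub>R frechet_derivative h (at (f x)) 1 =
        frechet_derivative (\<lambda>x. h (f x)) (at x) v" if "x \<in> S" for x
      using frechet_derivative_at[OF D[OF that]] by metis
  qed
  then show ?case using D by (auto simp: differentiable_def)
qed

lemma smooth_on_cong:
  "open S \<Longrightarrow> smooth_on S f \<Longrightarrow> (\<And>x. x \<in> S \<Longrightarrow> f x = g x) \<Longrightarrow> smooth_on S g"
  unfolding smooth_on_def using higher_differentiable_on_cong[of S f g] by blast

lemma smooth_on_subset: "smooth_on S f \<Longrightarrow> T \<subseteq> S \<Longrightarrow> smooth_on T f"
  unfolding smooth_on_def using higher_differentiable_on_mono by blast

lemma smooth_on_local:
  assumes "open S" "\<And>x. x \<in> S \<Longrightarrow> \<exists>U. open U \<and> x \<in> U \<and> smooth_on U f"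
  shows "smooth_on S f"
  using assms unfolding smooth_on_def by (metis higher_differentiable_on_local)

lemma smooth_on_const: "smooth_on S (\<lambda>x. c)"
  by (simp add: smooth_on_def higher_differentiable_on_const)

lemma smooth_on_add:
  "open S \<Longrightarrow> smooth_on S f \<Longrightarrow> smooth_on S g \<Longrightarrow> smooth_on S (\<lambda>x. f x + g x)"
  by (simp add: smooth_on_def higher_differentiable_on_add)

lemma smooth_on_bilinear:
  "bounded_bilinear B \<Longrightarrow> open S \<Longrightarrow> smooth_on S f \<Longrightarrow> smooth_on S g \<Longrightarrow>
    smooth_on S (\<lambda>x. B (f x) (g x))"
  by (simp add: smooth_on_def higher_differentiable_on_bilinear)

lemmas smooth_on_mult = smooth_on_bilinear[OF bounded_bilinear_mult]
lemmas smooth_on_scaleR = smooth_on_bilinear[OF bounded_bilinear_scaleR]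
lemmas smooth_on_inner = smooth_on_bilinear[OF bounded_bilinear_inner]

lemma smooth_on_diff:
  assumes "open S" "smooth_on S f" "smooth_on S g"
  shows "smooth_on S (\<lambda>x. f x - g x)"
  using smooth_on_add[OF assms(1,2) smooth_on_scaleR[OF assms(1) smooth_on_const[of S "-1"] assms(3)]]
  by simp

lemma smooth_on_sum:
  assumes "open S" "\<And>i. i \<in> I \<Longrightarrow> smooth_on S (f i)"
  shows "smooth_on S (\<lambda>x. \<Sum>i\<in>I. f i x)"
  using assms(2)
  by (induction I rule: infinite_finite_induct)
    (auto intro!: smooth_on_const smooth_on_add assms(1))

lemma smooth_on_prod:
  fixes f :: "'i \<Rightarrow> 'a::real_normed_vector \<Rightarrow> real"
  assumes "open S" "\<And>i. i \<in> I \<Longrightarrow> smooth_on S (f i)"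
  shows "smooth_on S (\<lambda>x. \<Prod>i\<in>I. f i x)"
  using assms(2)
  by (induction I rule: infinite_finite_induct)
    (auto intro!: smooth_on_const smooth_on_mult assms(1))

lemma smooth_on_compose:
  fixes h :: "real \<Rightarrow> 'b::real_normed_vector"
  assumes "open S" "smooth_on S f" "open T" "smooth_on T h" "\<And>x. x \<in> S \<Longrightarrow> f x \<in> T"
  shows "smooth_on S (\<lambda>x. h (f x))"
  unfolding smooth_on_def
proof
  fix k
  show "higher_differentiable_on k S (\<lambda>x. h (f x))"
    by (rule higher_differentiable_on_compose[where f=f and h=h, OF assms(1,3,5)])
      (use assms(2,4) in \<open>simp_all add: smooth_on_def\<close>)
qed

lemma smooth_on_nth:
  fixes f :: "'a::real_normed_vector \<Rightarrow> real ^ 'n"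
  assumes "open S" "smooth_on S f" shows "smooth_on S (\<lambda>x. f x $ i)"
  using smooth_on_inner[OF assms(1) smooth_on_const[of S "axis i (1::real)"] assms(2)]
  by (simp add: inner_axis')

lemma smooth_on_imp_differentiable: "smooth_on S f \<Longrightarrow> x \<in> S \<Longrightarrow> f differentiable at x"
  unfolding smooth_on_def by (metis higher_differentiable_on.simps(2))

lemma smooth_on_imp_continuous_on: "smooth_on S f \<Longrightarrow> continuous_on S f"
  unfolding smooth_on_def by (metis higher_differentiable_on.simps(1))

lemma smooth_on_frechet_derivative:
  "smooth_on S f \<Longrightarrow> smooth_on S (\<lambda>x. frechet_derivative f (at x) v)"
  unfolding smooth_on_def by (metis higher_differentiable_on.simps(2))

text \<open>Up to a constant the derivative is again a power, so the induction generalises over the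
  exponent. The exponents -1, 1/2 and 1/(2n) will give quotients, volume densities and the factor
  s.\<close>

lemma smooth_on_powr: "smooth_on {0<..} (\<lambda>x::real. x powr a)"
proof -
  have D: "((\<lambda>x. x powr a) has_derivative (\<lambda>v. v * (a * x powr (a - 1)))) (at x)" if "x > 0" for x a :: real
    using has_real_derivative_powr[OF that, of a] unfolding has_field_derivative_def
    by (metis (no_types, lifting) ext mult.commute)
  have "higher_differentiable_on k {0<..} (\<lambda>x::real. x powr a)" for k
  proof (induction k arbitrary: a)
    case 0
    then show ?case by (auto intro!: continuous_intros)
  next
    case (Suc k)
    have "higher_differentiable_on k {0<..} (\<lambda>x. frechet_derivative (\<lambda>x::real. x powr a) (at x) v)" for v
    proof (rule higher_differentiable_on_cong)
      show "higher_differentiable_on k {0<..} (\<lambda>x. (v * a) * x powr (a - 1))"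
        using Suc by (intro higher_differentiable_on_bilinear[OF bounded_bilinear_mult] higher_differentiable_on_const) auto
      show "v * a * x powr (a - 1) = frechet_derivative (\<lambda>x. x powr a) (at x) v" if "x \<in> {0<..}" for x
        using frechet_derivative_at[OF D, of x a] that by (metis greaterThan_iff mult.assoc)
    qed simp
    then show ?case using D by (auto simp: differentiable_def)
  qed
  then show ?thesis by (simp add: smooth_on_def)
qed

lemma smooth_on_powr_compose:
  fixes f :: "'a::real_normed_vector \<Rightarrow> real"
  assumes "open S" "smooth_on S f" "\<And>x. x \<in> S \<Longrightarrow> f x > 0"
  shows "smooth_on S (\<lambda>x. f x powr a)"
  using assms smooth_on_compose[OF assms(1,2) _ smooth_on_powr] by simp

lemma smooth_on_divide:
  fixes f :: "'a::real_normed_vector \<Rightarrow> real"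
  assumes "open S" "smooth_on S f" "smooth_on S g" "\<And>x. x \<in> S \<Longrightarrow> g x > 0"
  shows "smooth_on S (\<lambda>x. f x / g x)"
  by (rule smooth_on_cong[OF assms(1) smooth_on_mult[OF assms(1,2)
        smooth_on_powr_compose[OF assms(1,3,4), of "-1"]]])
    (use assms(4) in \<open>simp_all add: powr_minus_divide less_imp_le powr_one\<close>)

lemma linear_axis_expansion:
  fixes f :: "real ^ 'n \<Rightarrow> 'b::real_vector"
  assumes "linear f"
  shows "f u = (\<Sum>k\<in>UNIV. u $ k *\<^sub>R f (axis k 1))"
proof -
  have "f u = f (\<Sum>k\<in>UNIV. u $ k *\<^sub>R axis k 1)"
    using basis_expansion[of u] by (simp add: scalar_mult_eq_scaleR)
  then show ?thesis using assms by (simp add: linear_sum linear_scale)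
qed

text \<open>Smoothness of \<open>L\<close> is known only on constant vectors; expanding
  \<open>w x\<close> in the standard basis reduces the varying vector to these.\<close>

lemma smooth_on_linear_apply:
  fixes L :: "'a::real_normed_vector \<Rightarrow> real ^ 'n \<Rightarrow> 'b::real_normed_vector"
  assumes "open S" "smooth_on S w" "\<And>x. x \<in> S \<Longrightarrow> linear (L x)" "\<And>u. smooth_on S (\<lambda>x. L x u)"
  shows "smooth_on S (\<lambda>x. L x (w x))"
proof (rule smooth_on_cong[OF assms(1)])
  show "smooth_on S (\<lambda>x. \<Sum>i\<in>UNIV. (w x $ i) *\<^sub>R L x (axis i 1))"
    using assms by (intro smooth_on_sum smooth_on_scaleR smooth_on_nth)
  show "(\<Sum>i\<in>UNIV. (w x $ i) *\<^sub>R L x (axis i 1)) = L x (w x)" if "x \<in> S" for x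
    by (rule linear_axis_expansion[OF assms(3)[OF that], symmetric])
qed

section \<open>A smooth step function\<close>

text \<open>
  The parameter \<open>m\<close> makes the family closed under differentiation, up to linear combinations.
\<close>

definition smooth_step :: "nat \<Rightarrow> real \<Rightarrow> real" where
  "smooth_step m x = (if x > 0 then exp (- (1 / x)) * (1 / x) ^ m else 0)"

lemma smooth_step_has_derivative:
  "(smooth_step m has_real_derivative
     - real m * smooth_step (Suc m) x + smooth_step (m + 2) x) (at x)"
proof -
  consider "x > 0" | "x < 0" | "x = 0" by linarith
  then show ?thesis
  proof cases
    case 1
    have "((\<lambda>x. exp (- (1 / x)) * (1 / x) ^ m) has_real_derivative
        - real m * smooth_step (Suc m) x + smooth_step (m + 2) x) (at x)"
      using 1 by (auto intro!: derivative_eq_intros simp: smooth_step_def)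
         (cases m, auto simp: field_simps power2_eq_square)
    then show ?thesis
      by (rule has_field_derivative_transform_within_open[where S="{0<..}"])
        (use 1 in \<open>auto simp: smooth_step_def\<close>)
  next
    case 2
    have "((\<lambda>x. 0) has_real_derivative
        - real m * smooth_step (Suc m) x + smooth_step (m + 2) x) (at x)"
      using 2 by (auto simp: smooth_step_def)
    then show ?thesis
      by (rule has_field_derivative_transform_within_open[where S="{..<0}"])
        (use 2 in \<open>auto simp: smooth_step_def\<close>)
  next
    case 3
    \<comment> \<open>With y = 1 / h the quotient becomes y^(m + 1) * exp (- y), which tends to 0 as
      y grows.\<close>
    have R: "((\<lambda>h. smooth_step m h / h) \<longlongrightarrow> 0) (at_right 0)"
    proof (rule Lim_transform_eventually)
      have "((\<lambda>y. y ^ Suc m / exp y) \<longlongrightarrow> 0) (at_top :: real filter)"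
        by (rule tendsto_power_div_exp_0)
      from filterlim_compose[OF this filterlim_inverse_at_top_right]
      show "((\<lambda>h::real. inverse h ^ Suc m / exp (inverse h)) \<longlongrightarrow> 0) (at_right 0)" .
      show "\<forall>\<^sub>F h in at_right 0. inverse h ^ Suc m / exp (inverse h) = smooth_step m h / h"
        by (auto simp: eventually_at_filter smooth_step_def exp_minus divide_simps)
    qed
    have L: "((\<lambda>h. smooth_step m h / h) \<longlongrightarrow> 0) (at_left 0)"
      by (rule Lim_transform_eventually[OF tendsto_const])
        (auto simp: eventually_at_filter smooth_step_def)
    have "((\<lambda>h. smooth_step m h / h) \<longlongrightarrow> 0) (at 0)"
      using L R filterlim_at_split by blast
    then show ?thesis
      using 3 by (simp add: DERIV_def smooth_step_def)
  qed
qed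

lemma smooth_on_smooth_step: "smooth_on UNIV (smooth_step m)"
proof -
  have "higher_differentiable_on k UNIV (smooth_step m)" for k
  proof (induction k arbitrary: m)
    case 0
    show ?case
      using DERIV_isCont[OF smooth_step_has_derivative[of m]]
      by (simp add: continuous_at_imp_continuous_on)
  next
    case (Suc k)
    have eq: "frechet_derivative (smooth_step m) (at x) =
       (\<lambda>v. (- real m * smooth_step (Suc m) x + smooth_step (m + 2) x) * v)" for x
      using smooth_step_has_derivative[of m x] unfolding has_field_derivative_def
      by (simp add: frechet_derivative_at[symmetric])
    have "higher_differentiable_on k UNIV
       (\<lambda>x. (- real m * smooth_step (Suc m) x + smooth_step (m + 2) x) * v)" for v
      using Suc by (intro higher_differentiable_on_bilinear[OF bounded_bilinear_mult]
          higher_differentiable_on_const higher_differentiable_on_add) auto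
    then show ?case
      using smooth_step_has_derivative[of m] unfolding higher_differentiable_on.simps eq
      by (auto simp: has_field_derivative_def differentiable_def)
  qed
  then show ?thesis by (simp add: smooth_on_def)
qed

section \<open>Symmetry of second derivatives\<close>

text \<open>The mean value theorem is used twice: along \<open>u\<close> for the difference of
  \<open>f\<close> between two lines that are shifted by \<open>h *\<^sub>R v\<close>, then along
  \<open>v\<close> for the derivative of \<open>f\<close> in direction \<open>u\<close>. The
  left-hand side is symmetric in \<open>u\<close> and \<open>v\<close>, which is the point of the
  lemma.\<close>

lemma mixed_difference_quotient:
  fixes f :: "'a::real_normed_vector \<Rightarrow> real"
  assumes f: "\<And>y. y \<in> ball x e \<Longrightarrow> f differentiable at y"
    and g: "\<And>y. y \<in> ball x e \<Longrightarrow> (\<lambda>z. frechet_derivative f (at z) u) differentiable at y"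
    and h: "0 < h" "h * (norm u + norm v) < e"
  shows "\<exists>y. dist x y \<le> h * (norm u + norm v) \<and>
    f (x + h *\<^sub>R u + h *\<^sub>R v) - f (x + h *\<^sub>R u) - f (x + h *\<^sub>R v) + f x =
    h * h * frechet_derivative (\<lambda>z. frechet_derivative f (at z) u) (at y) v"
proof -
  have near: "dist x (x + s *\<^sub>R u + t *\<^sub>R v) \<le> h * (norm u + norm v)"
    if "0 \<le> s" "s \<le> h" "0 \<le> t" "t \<le> h" for s t
  proof -
    have "norm (s *\<^sub>R u + t *\<^sub>R v) \<le> s * norm u + t * norm v"
      using that norm_triangle_ineq[of "s *\<^sub>R u" "t *\<^sub>R v"] by simp
    also have "\<dots> \<le> h * norm u + h * norm v"
      using that by (intro add_mono mult_right_mono) auto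
    finally show ?thesis by (simp add: dist_norm algebra_simps norm_minus_commute)
  qed
  have in_ball: "x + s *\<^sub>R u + t *\<^sub>R v \<in> ball x e"
    if "0 \<le> s" "s \<le> h" "0 \<le> t" "t \<le> h" for s t
    using near[OF that] h by auto
  have line: "((\<lambda>s. F (a + s *\<^sub>R w)) has_real_derivative frechet_derivative F (at (a + s *\<^sub>R w)) w) (at s)"
    if "F differentiable at (a + s *\<^sub>R w)" for F :: "'a \<Rightarrow> real" and a w s
  proof -
    have F: "(F has_derivative frechet_derivative F (at (a + s *\<^sub>R w))) (at (a + s *\<^sub>R w))"
      using that by (simp add: frechet_derivative_works)
    have "((\<lambda>s. a + s *\<^sub>R w) has_derivative (\<lambda>c. c *\<^sub>R w)) (at s)"
      by (auto intro!: derivative_eq_intros)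
    from diff_chain_at[OF this F] show ?thesis
      using linear_scale[OF has_derivative_linear[OF F], of _ w]
      by (simp add: has_field_derivative_def o_def mult_commute_abs)
  qed
  have *: "((\<lambda>s. f (x + s *\<^sub>R u + h *\<^sub>R v) - f (x + s *\<^sub>R u)) has_real_derivative
      frechet_derivative f (at (x + s *\<^sub>R u + h *\<^sub>R v)) u - frechet_derivative f (at (x + s *\<^sub>R u)) u) (at s)"
    if "0 \<le> s" "s \<le> h" for s
    using line[of f "x + h *\<^sub>R v" s u] line[of f x s u] f[OF in_ball, of s h] f[OF in_ball, of s 0] that h
    by (auto intro!: DERIV_diff simp: algebra_simps)
  obtain s where s: "0 < s" "s < h" and
    eq1: "(f (x + h *\<^sub>R u + h *\<^sub>R v) - f (x + h *\<^sub>R u)) - (f (x + 0 *\<^sub>R u + h *\<^sub>R v) - f (x + 0 *\<^sub>R u)) =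
      (h - 0) * (frechet_derivative f (at (x + s *\<^sub>R u + h *\<^sub>R v)) u - frechet_derivative f (at (x + s *\<^sub>R u)) u)"
    using MVT2[OF h(1) *] by auto
  have **: "((\<lambda>t. frechet_derivative f (at (x + s *\<^sub>R u + t *\<^sub>R v)) u) has_real_derivative
      frechet_derivative (\<lambda>z. frechet_derivative f (at z) u) (at (x + s *\<^sub>R u + t *\<^sub>R v)) v) (at t)"
    if "0 \<le> t" "t \<le> h" for t
    using that s by (intro line[of _ "x + s *\<^sub>R u"] g in_ball) auto
  obtain t where t: "0 < t" "t < h" and
    eq2: "frechet_derivative f (at (x + s *\<^sub>R u + h *\<^sub>R v)) u - frechet_derivative f (at (x + s *\<^sub>R u + 0 *\<^sub>R v)) u =
      (h - 0) * frechet_derivative (\<lambda>z. frechet_derivative f (at z) u) (at (x + s *\<^sub>R u + t *\<^sub>R v)) v"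
    using MVT2[OF h(1) **] by auto
  show ?thesis
    using near[of s t] s t eq1 eq2 by (intro exI[of _ "x + s *\<^sub>R u + t *\<^sub>R v"]) auto
qed

text \<open>The second difference is the same for both orders of \<open>u\<close> and
  \<open>v\<close>, so the two mixed derivatives take a common value at points arbitrarily close to
  \<open>x\<close>; by continuity they agree at \<open>x\<close>.\<close>

lemma second_derivative_symmetric:
  fixes f :: "'a::real_normed_vector \<Rightarrow> real"
  assumes "open S" "x \<in> S" "smooth_on S f"
  shows "frechet_derivative (\<lambda>y. frechet_derivative f (at y) u) (at x) v =
    frechet_derivative (\<lambda>y. frechet_derivative f (at y) v) (at x) u"
    (is "?A x = ?B x")
proof -
  obtain e where e: "e > 0" "ball x e \<subseteq> S"
    using assms openE by blast
  have df: "f differentiable at y" if "y \<in> ball x e" for y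
    using that e assms(3) smooth_on_imp_differentiable by blast
  have dD: "(\<lambda>z. frechet_derivative f (at z) w) differentiable at y" if "y \<in> ball x e" for y w
    using that e assms(3) smooth_on_imp_differentiable smooth_on_frechet_derivative by blast
  have cont: "isCont (\<lambda>y. frechet_derivative (\<lambda>y. frechet_derivative f (at y) a) (at y) b) x" for a b
    using smooth_on_imp_continuous_on[OF smooth_on_frechet_derivative[OF smooth_on_frechet_derivative[OF assms(3)]], of a b]
      assms(2) by (simp add: continuous_on_eq_continuous_at[OF assms(1)])
  have le: "dist (?A x) (?B x) \<le> \<epsilon>" if "\<epsilon> > 0" for \<epsilon>
  proof -
    obtain d1 where d1: "d1 > 0" "\<And>y. dist y x < d1 \<Longrightarrow> dist (?A y) (?A x) < \<epsilon> / 2"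
      using cont[of u v] \<open>\<epsilon> > 0\<close> unfolding continuous_at_eps_delta by (meson half_gt_zero)
    obtain d2 where d2: "d2 > 0" "\<And>y. dist y x < d2 \<Longrightarrow> dist (?B y) (?B x) < \<epsilon> / 2"
      using cont[of v u] \<open>\<epsilon> > 0\<close> unfolding continuous_at_eps_delta by (meson half_gt_zero)
    define d where "d = min e (min d1 d2)"
    \<comment> \<open>The summand 1 keeps the denominator positive when both vectors vanish and
      makes the bound by \<open>d\<close> strict.\<close>
    define h where "h = d / (norm u + norm v + 1)"
    have "d > 0" using e d1 d2 by (simp add: d_def)
    then have h: "h > 0" by (simp add: h_def add_nonneg_pos)
    have "h * (norm u + norm v) < h * (norm u + norm v + 1)" using h by simp
    also have "\<dots> = d" unfolding h_def using norm_ge_zero[of u] norm_ge_zero[of v]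
      by (simp add: add_nonneg_eq_0_iff)
    finally have hd: "h * (norm u + norm v) < d" .
    then have he: "h * (norm u + norm v) < e" "h * (norm v + norm u) < e"
      by (auto simp: d_def add.commute)
    obtain y where y: "dist x y \<le> h * (norm u + norm v)"
      "f (x + h *\<^sub>R u + h *\<^sub>R v) - f (x + h *\<^sub>R u) - f (x + h *\<^sub>R v) + f x = h * h * ?A y"
      using mixed_difference_quotient[OF df dD h he(1)] by blast
    obtain z where z: "dist x z \<le> h * (norm v + norm u)"
      "f (x + h *\<^sub>R v + h *\<^sub>R u) - f (x + h *\<^sub>R v) - f (x + h *\<^sub>R u) + f x = h * h * ?B z"
      using mixed_difference_quotient[OF df dD h he(2)] by blast
    have "x + h *\<^sub>R v + h *\<^sub>R u = x + h *\<^sub>R u + h *\<^sub>R v" by simp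
    then have "h * h * ?A y = h * h * ?B z"
      using y(2) z(2)[unfolded \<open>x + h *\<^sub>R v + h *\<^sub>R u = x + h *\<^sub>R u + h *\<^sub>R v\<close>] by linarith
    then have eq: "?A y = ?B z" using h by simp
    have "dist y x < d1" "dist z x < d2"
      using y(1) z(1) hd by (simp_all add: d_def dist_commute add.commute)
    then have "dist (?A y) (?A x) < \<epsilon> / 2" "dist (?A y) (?B x) < \<epsilon> / 2"
      unfolding eq using d1(2)[of y] d2(2)[of z] eq by simp_all
    then show ?thesis
      using dist_triangle3[of "?A x" "?B x" "?A y"] by linarith
  qed
  have "dist (?A x) (?B x) \<le> 0"
  proof (rule field_le_epsilon)
    show "dist (?A x) (?B x) \<le> 0 + e" if "0 < e" for e using le[OF that] by simp
  qed
  then show ?thesis by simp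
qed

section \<open>Alternating forms\<close>

lemma alternating_form_cong:
  "alternating_form k \<omega> \<Longrightarrow> (\<And>i. i < k \<Longrightarrow> v i = w i) \<Longrightarrow> \<omega> v = \<omega> w"
  unfolding alternating_form_def by blast

lemma alternating_form_linear:
  "alternating_form k \<omega> \<Longrightarrow> i < k \<Longrightarrow> linear (\<lambda>u. \<omega> (v(i := u)))"
  unfolding alternating_form_def by blast

lemma alternating_form_eq_0:
  "alternating_form k \<omega> \<Longrightarrow> i < k \<Longrightarrow> j < k \<Longrightarrow> i \<noteq> j \<Longrightarrow> v i = v j \<Longrightarrow> \<omega> v = 0"
  unfolding alternating_form_def by blast

lemma alternating_form_scale:
  "alternating_form k \<omega> \<Longrightarrow> i < k \<Longrightarrow> \<omega> (v(i := c *\<^sub>R u)) = c * \<omega> (v(i := u))"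
  using linear_scale[OF alternating_form_linear] by fastforce

lemma alternating_form_zero:
  "alternating_form k \<omega> \<Longrightarrow> i < k \<Longrightarrow> v i = 0 \<Longrightarrow> \<omega> v = 0"
  using linear_0[OF alternating_form_linear, of k \<omega> i v] by (metis fun_upd_triv)

text \<open>Polarisation: the form vanishes with \<open>v i + v j\<close> in both slots, and only
  the two mixed terms of the expansion survive.\<close>

lemma alternating_form_swap:
  assumes \<omega>: "alternating_form k \<omega>" and ij: "i < k" "j < k" "i \<noteq> j"
  shows "\<omega> (v \<circ> Transposition.transpose i j) = - \<omega> v"
proof -
  define W where "W a b = \<omega> (v(i := a, j := b))" for a b
  have diag: "W a a = 0" for a
    unfolding W_def using ij by (intro alternating_form_eq_0[OF \<omega> ij]) auto
  have lin1: "linear (\<lambda>a. W a b)" for b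
    unfolding W_def using alternating_form_linear[OF \<omega> ij(1), of "v(j := b)"] ij(3)
    by (simp add: fun_upd_twist)
  have lin2: "linear (\<lambda>b. W a b)" for a
    unfolding W_def using alternating_form_linear[OF \<omega> ij(2)] .
  have "0 = W (v i + v j) (v i + v j)" using diag by simp
  also have "\<dots> = W (v i) (v j) + W (v j) (v i)"
    unfolding linear_add[OF lin1] linear_add[OF lin2] by (simp add: diag)
  finally have "W (v j) (v i) = - W (v i) (v j)" by simp
  moreover have "v \<circ> Transposition.transpose i j = v(i := v j, j := v i)"
    using ij by (auto simp: Transposition.transpose_def fun_eq_iff)
  ultimately show ?thesis by (simp add: W_def)
qed

lemma alternating_form_scale_all:
  assumes "alternating_form k \<omega>"
  shows "\<omega> (\<lambda>j. c j *\<^sub>R v j) = (\<Prod>j<k. c j) * \<omega> v"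
proof -
  have "\<omega> (\<lambda>j. if j < m then c j *\<^sub>R v j else v j) = (\<Prod>j<m. c j) * \<omega> v" if "m \<le> k" for m
    using that
  proof (induction m)
    case (Suc m)
    let ?w = "\<lambda>j. if j < m then c j *\<^sub>R v j else v j"
    have "(\<lambda>j. if j < Suc m then c j *\<^sub>R v j else v j) = ?w(m := c m *\<^sub>R v m)"
      by (auto simp: fun_eq_iff less_Suc_eq)
    moreover have "?w(m := v m) = ?w" by auto
    ultimately show ?case
      using Suc alternating_form_scale[OF assms, of m ?w "c m" "v m"] by simp
  qed simp
  from this[of k] show ?thesis
    using alternating_form_cong[OF assms, of "\<lambda>j. c j *\<^sub>R v j" "\<lambda>j. if j < k then c j *\<^sub>R v j else v j"]
    by simp
qed

lemma alternating_form_linear_image: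
  fixes P :: "real ^ 'n::finite \<Rightarrow> real ^ 'n"
  assumes "alternating_form k \<omega>" "linear P"
  shows "alternating_form k (\<lambda>v. \<omega> (\<lambda>j. P (v j)))"
  unfolding alternating_form_def
proof (intro conjI allI impI)
  fix v w :: "nat \<Rightarrow> real ^ 'n" assume "\<forall>i<k. v i = w i"
  then show "\<omega> (\<lambda>j. P (v j)) = \<omega> (\<lambda>j. P (w j))"
    by (intro alternating_form_cong[OF assms(1)]) simp
next
  fix v :: "nat \<Rightarrow> real ^ 'n" and i assume "i < k"
  have eq: "(\<lambda>j. P ((v(i := u)) j)) = (\<lambda>j. P (v j))(i := P u)" for u by auto
  show "linear (\<lambda>u. \<omega> (\<lambda>j. P ((v(i := u)) j)))"
    using linear_compose[OF assms(2) alternating_form_linear[OF assms(1) \<open>i < k\<close>, of "\<lambda>j. P (v j)"]]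
    unfolding eq o_def .
next
  fix v :: "nat \<Rightarrow> real ^ 'n" and i j assume "i < k" "j < k" "i \<noteq> j \<and> v i = v j"
  then show "\<omega> (\<lambda>j. P (v j)) = 0"
    by (intro alternating_form_eq_0[OF assms(1), of i j]) auto
qed

text \<open>Every permutation is a product of transpositions. \<open>F\<close> is an arbitrary
  function and \<open>S\<close> an arbitrary finite set of slots, so that the lemma also fits a form
  reading its arguments from shifted slots.\<close>

lemma antisymmetric_permute:
  assumes "\<sigma> permutes S" "finite S"
    and "\<And>v i j. i \<in> S \<Longrightarrow> j \<in> S \<Longrightarrow> i \<noteq> j \<Longrightarrow> F (v \<circ> Transposition.transpose i j) = - F v"
  shows "F (v \<circ> \<sigma>) = of_int (sign \<sigma>) * (F v :: real)"
proof -
  have "\<forall>v. F (v \<circ> \<sigma>) = of_int (sign \<sigma>) * (F v :: real)"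
    using assms(1,2)
  proof (induction rule: permutes_induct)
    case id
    then show ?case by simp
  next
    case (swap a b p)
    have "sign (Transposition.transpose a b \<circ> p) = - sign p"
      using swap assms(2) by (simp add: sign_compose permutation_swap_id permutes_imp_permutation sign_swap_id)
    moreover have "F (v \<circ> (Transposition.transpose a b \<circ> p)) = of_int (sign p) * - F v" for v
      using swap assms(3)[OF swap(1-3), of v] by (simp add: comp_assoc[symmetric] del: comp_apply)
    ultimately show ?case by (simp del: comp_apply)
  qed
  then show ?thesis by blast
qed

lemma alternating_form_wedge:
  fixes \<omega> \<eta> :: "'n::finite alt_form"
  assumes \<omega>: "alternating_form k \<omega>" and \<eta>: "alternating_form l \<eta>"
  shows "alternating_form (k + l) (wedge k l \<omega> \<eta>)"
  unfolding alternating_form_def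
proof (intro conjI allI impI)
  fix v w :: "nat \<Rightarrow> real ^ 'n" assume vw: "\<forall>i<k + l. v i = w i"
  have "\<omega> (\<lambda>i. v (\<sigma> i)) = \<omega> (\<lambda>i. w (\<sigma> i)) \<and> \<eta> (\<lambda>i. v (\<sigma> (k + i))) = \<eta> (\<lambda>i. w (\<sigma> (k + i)))"
    if "\<sigma> permutes {..<k + l}" for \<sigma>
    using permutes_in_image[OF that] vw
    by (intro conjI alternating_form_cong[OF \<omega>] alternating_form_cong[OF \<eta>]) auto
  then show "wedge k l \<omega> \<eta> v = wedge k l \<omega> \<eta> w"
    unfolding wedge_def by simp
next
  fix v :: "nat \<Rightarrow> real ^ 'n" and i assume i: "i < k + l"
  have "linear (\<lambda>u. of_int (sign \<sigma>) * \<omega> (\<lambda>m. (v(i := u)) (\<sigma> m)) * \<eta> (\<lambda>m. (v(i := u)) (\<sigma> (k + m))))"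
    if \<sigma>: "\<sigma> permutes {..<k + l}" for \<sigma>
  proof -
    \<comment> \<open>Exactly one index is sent to \<open>i\<close>, so the varying vector enters
      only one of the two factors: the first if \<open>j < k\<close>, else the second in slot
      \<open>j - k\<close>.\<close>
    obtain j where j: "\<sigma> j = i" "j < k + l"
      using \<sigma> i by (metis lessThan_iff permutes_def permutes_in_image)
    have inj: "\<sigma> m = i \<longleftrightarrow> m = j" for m
      using j permutes_inj[OF \<sigma>] by (auto dest: injD)
    show ?thesis
    proof (cases "j < k")
      case True
      have "(\<lambda>m. (v(i := u)) (\<sigma> m)) = (\<lambda>m. v (\<sigma> m))(j := u)" for u
        by (auto simp: inj)
      moreover have "(\<lambda>m. (v(i := u)) (\<sigma> (k + m))) = (\<lambda>m. v (\<sigma> (k + m)))" for u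
        using True by (auto simp: inj)
      ultimately show ?thesis
        using linear_compose[OF alternating_form_linear[OF \<omega> True, of "\<lambda>m. v (\<sigma> m)"],
            of "\<lambda>t. of_int (sign \<sigma>) * t * \<eta> (\<lambda>m. v (\<sigma> (k + m)))"]
        by (simp add: o_def linear_iff algebra_simps)
    next
      case False
      then have "(\<lambda>m. (v(i := u)) (\<sigma> (k + m))) = (\<lambda>m. v (\<sigma> (k + m)))(j - k := u)" for u
        by (auto simp: inj fun_eq_iff)
      moreover have "\<omega> (\<lambda>m. (v(i := u)) (\<sigma> m)) = \<omega> (\<lambda>m. v (\<sigma> m))" for u
        using False by (intro alternating_form_cong[OF \<omega>]) (auto simp: inj)
      moreover have "j - k < l" using False j by simp
      ultimately show ?thesis
        using linear_compose[OF alternating_form_linear[OF \<eta>, of "j - k" "\<lambda>m. v (\<sigma> (k + m))"],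
            of "\<lambda>t. of_int (sign \<sigma>) * \<omega> (\<lambda>m. v (\<sigma> m)) * t"]
        by (simp add: o_def linear_iff algebra_simps)
    qed
  qed
  then have "linear (\<lambda>u. (1 / (fact k * fact l)) *\<^sub>R (\<Sum>\<sigma> | \<sigma> permutes {..<k + l}.
      of_int (sign \<sigma>) * \<omega> (\<lambda>m. (v(i := u)) (\<sigma> m)) * \<eta> (\<lambda>m. (v(i := u)) (\<sigma> (k + m)))))"
    by (intro linear_compose_scale_right linear_compose_sum) auto
  then show "linear (\<lambda>u. wedge k l \<omega> \<eta> (v(i := u)))"
    by (simp add: wedge_def)
next
  fix v :: "nat \<Rightarrow> real ^ 'n" and i j assume ij: "i < k + l" "j < k + l" "i \<noteq> j \<and> v i = v j"
  define t where "t = Transposition.transpose i j"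
  define G where "G w = \<omega> w * \<eta> (\<lambda>m. w (k + m))" for w
  define P where "P = {\<sigma>. \<sigma> permutes {..<k + l}}"
  have tt: "t \<circ> (t \<circ> \<sigma>) = \<sigma>" for \<sigma> by (simp add: t_def comp_assoc[symmetric])
  have tP: "t \<circ> \<sigma> \<in> P" "sign (t \<circ> \<sigma>) = - sign \<sigma>" if "\<sigma> \<in> P" for \<sigma>
  proof -
    have "t permutes {..<k + l}" unfolding t_def using ij by (intro permutes_swap_id) auto
    then show "t \<circ> \<sigma> \<in> P" using that by (simp add: P_def permutes_compose)
    have "permutation \<sigma>" using that by (auto simp: P_def intro: permutes_imp_permutation[of "{..<k + l}"])
    then show "sign (t \<circ> \<sigma>) = - sign \<sigma>"
      using ij by (simp add: t_def sign_compose permutation_swap_id sign_swap_id)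
  qed
  have vt: "v \<circ> (t \<circ> \<sigma>) = v \<circ> \<sigma>" for \<sigma>
    using ij by (auto simp: t_def Transposition.transpose_def fun_eq_iff)
  \<comment> \<open>Composing with \<open>t\<close> is an involution of the permutations that
    reverses the sign and, as \<open>v i = v j\<close>, does not change the arguments. The sum
    therefore equals its own negative.\<close>
  have "(\<Sum>\<sigma>\<in>P. of_int (sign \<sigma>) * G (v \<circ> \<sigma>)) = (\<Sum>\<sigma>\<in>P. - (of_int (sign \<sigma>) * G (v \<circ> \<sigma>)))"
    by (rule sum.reindex_bij_witness[where i="\<lambda>\<sigma>. t \<circ> \<sigma>" and j="\<lambda>\<sigma>. t \<circ> \<sigma>"]) (simp_all only: tt tP vt of_int_minus minus_mult_left minus_minus)
  then have "(\<Sum>\<sigma>\<in>P. of_int (sign \<sigma>) * G (v \<circ> \<sigma>)) = 0"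
    by (simp add: sum_negf)
  then show "wedge k l \<omega> \<eta> v = 0"
    by (simp add: wedge_def P_def G_def mult.assoc o_def)
qed

section \<open>Top-degree forms as multiples of the determinant\<close>

abbreviation coord_rank :: "'n::{finite, linorder} \<Rightarrow> nat" where
  "coord_rank i \<equiv> card {..<i}"

definition coord_at :: "nat \<Rightarrow> 'n::{finite, linorder}" where
  "coord_at = inv_into UNIV coord_rank"

definition standard_frame :: "nat \<Rightarrow> real ^ 'n::{finite, linorder}" where
  "standard_frame j = axis (coord_at j) 1"

lemma coord_rank_bij: "bij_betw (coord_rank :: 'n::{finite, linorder} \<Rightarrow> nat) UNIV {..<CARD('n)}"
proof -
  have mono: "coord_rank i < coord_rank j" if "i < j" for i j :: 'n
    using that by (intro psubset_card_mono) auto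
  have inj: "inj (coord_rank :: 'n \<Rightarrow> nat)"
  proof (rule injI)
    fix i j :: 'n assume "coord_rank i = coord_rank j"
    then show "i = j" using mono[of i j] mono[of j i] by (cases i j rule: linorder_cases) auto
  qed
  have "coord_rank i < CARD('n)" for i :: 'n
    by (intro psubset_card_mono) auto
  then have "range (coord_rank :: 'n \<Rightarrow> nat) = {..<CARD('n)}"
    by (intro card_subset_eq) (auto simp: card_image[OF inj])
  with inj show ?thesis by (simp add: bij_betw_def)
qed

lemma coord_at_rank [simp]: "coord_at (coord_rank i) = i"
  unfolding coord_at_def using coord_rank_bij by (intro inv_f_f) (auto simp: bij_betw_def)

lemma coord_rank_less [simp]: "coord_rank (i :: 'n::{finite, linorder}) < CARD('n)"
  using coord_rank_bij by (auto simp: bij_betw_def)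

lemma coord_rank_at [simp]: "j < CARD('n) \<Longrightarrow> coord_rank (coord_at j :: 'n::{finite, linorder}) = j"
  unfolding coord_at_def using coord_rank_bij[where 'n='n] by (intro f_inv_into_f) (auto simp: bij_betw_def)

lemma coord_at_bij: "bij_betw (coord_at :: nat \<Rightarrow> 'n::{finite, linorder}) {..<CARD('n)} UNIV"
  unfolding coord_at_def using coord_rank_bij by (rule bij_betw_inv_into)

lemma det_standard_frame [simp]: "det (\<chi> i::'n::{finite, linorder}. standard_frame (coord_rank i)) = 1"
proof -
  have "(\<chi> i::'n. standard_frame (coord_rank i)) = mat 1"
    by (simp add: standard_frame_def mat_def axis_def vec_eq_iff)
  then show ?thesis by (simp add: det_I)
qed

text \<open>Both sides respond alike to the matrix operations that reduce every matrix to a diagonal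
  one or one with a zero row. The induction quantifies over all forms because a swap of columns is
  not an operation on the arguments: it is absorbed by pulling the form back along the corresponding
  swap of coordinates.\<close>

lemma top_form_eq_det:
  fixes \<omega> :: "'n::{finite, linorder} alt_form"
  assumes "alternating_form CARD('n) \<omega>"
  shows "\<omega> v = det (\<chi> i. v (coord_rank i)) * \<omega> standard_frame"
proof -
  define rows :: "real ^ 'n::{finite, linorder} ^ 'n::{finite, linorder} \<Rightarrow> nat \<Rightarrow> real ^ 'n::{finite, linorder}" where "rows M j = M $ coord_at j" for M j
  have "\<forall>\<omega>. alternating_form CARD('n) \<omega> \<longrightarrow> \<omega> (rows M) = det M * \<omega> standard_frame" for M
  proof (induction M rule: induct_matrix_row_operations)
    case (1 M i)
    then have "rows M (coord_rank i) = 0"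
      by (simp add: rows_def row_def vec_lambda_eta)
    then show ?case
      using alternating_form_zero[OF _ coord_rank_less, of _ "rows M" i] 1 by (simp add: det_zero_row)
  next
    case (2 M)
    show ?case
    proof (intro allI impI)
      fix \<omega> :: "'n alt_form" assume \<omega>: "alternating_form CARD('n) \<omega>"
      have "rows M = (\<lambda>j. (M $ coord_at j $ coord_at j) *\<^sub>R standard_frame j)"
        using 2 by (auto simp: fun_eq_iff rows_def standard_frame_def vec_eq_iff axis_def)
      then have "\<omega> (rows M) = (\<Prod>j<CARD('n). M $ coord_at j $ coord_at j) * \<omega> standard_frame"
        by (simp add: alternating_form_scale_all[OF \<omega>])
      also have "(\<Prod>j<CARD('n). M $ coord_at j $ coord_at j) = (\<Prod>i\<in>UNIV. M $ i $ i)"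
        by (rule prod.reindex_bij_betw[OF coord_at_bij])
      also have "\<dots> = det M" using 2 by (simp add: det_diagonal)
      finally show "\<omega> (rows M) = det M * \<omega> standard_frame" .
    qed
  next
    case (3 M m n)
    show ?case
    proof (intro allI impI)
      fix \<omega> :: "'n alt_form" assume \<omega>: "alternating_form CARD('n) \<omega>"
      define P :: "real ^ 'n::{finite, linorder} \<Rightarrow> real ^ 'n::{finite, linorder}" where "P x = (\<chi> j. x $ Transposition.transpose m n j)" for x
      have P: "linear P" by (simp add: linear_iff P_def vec_eq_iff)
      let ?M = "\<chi> i j. M $ i $ Transposition.transpose m n j"
      have "rows ?M = (\<lambda>j. P (rows M j))"
        by (simp add: fun_eq_iff rows_def P_def)
      then have "\<omega> (rows ?M) = det M * \<omega> (\<lambda>j. P (standard_frame j))"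
        using 3(1)[rule_format, OF alternating_form_linear_image[OF \<omega> P]] by simp
      \<comment> \<open>On the standard frame, swapping coordinates amounts to swapping two of the
        vectors, which costs a sign.\<close>
      also have "\<omega> (\<lambda>j. P (standard_frame j)) = \<omega> (standard_frame \<circ> Transposition.transpose (coord_rank m) (coord_rank n))"
      proof (rule alternating_form_cong[OF \<omega>])
        fix j assume "j < CARD('n)"
        have "coord_at (Transposition.transpose (coord_rank m) (coord_rank n) j) = Transposition.transpose m n (coord_at j :: 'n)"
          using \<open>j < CARD('n)\<close> coord_rank_at[where 'n='n, of j] by (auto simp: Transposition.transpose_def)
        then show "P (standard_frame j) = (standard_frame \<circ> Transposition.transpose (coord_rank m) (coord_rank n)) j"
          by (auto simp: P_def standard_frame_def vec_eq_iff axis_def transpose_eq_iff)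
      qed
      also have "\<dots> = - \<omega> standard_frame"
      proof (rule alternating_form_swap[OF \<omega>])
        show "coord_rank m \<noteq> coord_rank n" using 3(2) by (metis coord_at_rank)
      qed auto
      also have "det M * - \<omega> standard_frame = det ?M * \<omega> standard_frame"
        using det_permute_columns[of "Transposition.transpose m n" M] 3(2)
        by (simp add: sign_swap_id permutes_swap_id)
      finally show "\<omega> (rows ?M) = det ?M * \<omega> standard_frame" .
    qed
  next
    case (4 M m n c)
    show ?case
    proof (intro allI impI)
      fix \<omega> :: "'n alt_form" assume \<omega>: "alternating_form CARD('n) \<omega>"
      let ?M = "\<chi> i. if i = m then row m M + c *\<^sub>R row n M else row i M"
      have mn: "coord_rank m \<noteq> coord_rank n" using 4(2) by (metis coord_at_rank)
      let ?L = "\<lambda>u. \<omega> ((rows M)(coord_rank m := u))"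
      have L: "linear ?L" using alternating_form_linear[OF \<omega> coord_rank_less] .
      have "\<omega> (rows ?M) = ?L (rows M (coord_rank m) + c *\<^sub>R rows M (coord_rank n))"
      proof (rule alternating_form_cong[OF \<omega>])
        fix j assume "j < CARD('n)"
        then have "coord_at j = m \<longleftrightarrow> j = coord_rank m" by (metis coord_rank_at coord_at_rank)
        then show "rows ?M j = ((rows M)(coord_rank m := rows M (coord_rank m) + c *\<^sub>R rows M (coord_rank n))) j"
          by (auto simp: rows_def row_def vec_lambda_eta)
      qed
      also have "\<dots> = ?L (rows M (coord_rank m)) + c * ?L (rows M (coord_rank n))"
        by (simp add: linear_add[OF L] linear_scale[OF L])
      also have "?L (rows M (coord_rank n)) = 0"
        using mn by (intro alternating_form_eq_0[OF \<omega>, of "coord_rank m" "coord_rank n"]) auto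
      also have "?L (rows M (coord_rank m)) = det M * \<omega> standard_frame"
        using 4(1) \<omega> by simp
      also have "det M = det ?M"
        by (rule det_row_operation[OF 4(2), of M c, unfolded scalar_mult_eq_scaleR, symmetric])
      finally show "\<omega> (rows ?M) = det ?M * \<omega> standard_frame" by simp
    qed
  qed
  from this[of "\<chi> i. v (coord_rank i)"] have "\<omega> (rows (\<chi> i. v (coord_rank i))) = det (\<chi> i. v (coord_rank i)) * \<omega> standard_frame"
    using assms by blast
  also have "\<omega> (rows (\<chi> i. v (coord_rank i))) = \<omega> v"
    by (rule alternating_form_cong[OF assms]) (simp add: rows_def)
  finally show ?thesis .
qed

section \<open>Contraction of a wedge product with a one-form\<close>

text \<open>Contraction fills slot 0; a transposition brings \<open>x\<close> there from slot
  \<open>m\<close> at the cost of a sign.\<close>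

lemma contract_eq_0_imp:
  assumes \<omega>: "alternating_form k \<omega>" and "\<And>v. contract k x \<omega> v = 0" and m: "m < k" "u m = x"
  shows "\<omega> u = 0"
proof (cases "m = 0")
  case True
  have "case_nat x (\<lambda>i. u (Suc i)) = u" using True m by (auto simp: fun_eq_iff split: nat.split)
  then show ?thesis using assms(2)[of "\<lambda>i. u (Suc i)"] m by (simp add: contract_def)
next
  case False
  let ?w = "u \<circ> Transposition.transpose 0 m"
  have "case_nat x (\<lambda>i. ?w (Suc i)) = ?w" using m by (auto simp: fun_eq_iff split: nat.split)
  then have "\<omega> ?w = 0" using assms(2)[of "\<lambda>i. ?w (Suc i)"] m by (simp add: contract_def)
  then show ?thesis using alternating_form_swap[OF \<omega>, of 0 m u] False m by simp
qed

text \<open>This is the derivation rule for the contraction of a \<and> \<omega> with x, whose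
  second term vanishes as x annihilates \<omega>. In the sum only the permutations fixing 0 survive;
  there are k! of them with equal contributions, which cancels the normalisation of
  \<open>wedge\<close>.\<close>

lemma wedge_one_form_contract:
  fixes \<omega> :: "'n::finite alt_form"
  assumes \<omega>: "alternating_form k \<omega>" and a: "alternating_form 1 a" and x: "\<And>v. contract k x \<omega> v = 0"
  shows "wedge 1 k a \<omega> (case_nat x v) = a (\<lambda>_. x) * \<omega> v"
proof -
  let ?w = "case_nat x v"
  define t where "t \<sigma> = of_int (sign \<sigma>) * a (\<lambda>i. ?w (\<sigma> i)) * \<omega> (\<lambda>i. ?w (\<sigma> (1 + i)))" for \<sigma>
  define P where "P = {\<sigma>. \<sigma> permutes {..<1 + k}}"
  define C where "C = {\<sigma>. \<sigma> permutes {1..k}}"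
  have sub: "C \<subseteq> P" unfolding C_def P_def by (auto intro: permutes_subset)
  have C0: "\<sigma> 0 = 0" if "\<sigma> \<in> C" for \<sigma>
    using that by (auto simp: C_def permutes_def)
  \<comment> \<open>A permutation moving 0 puts \<open>x\<close> among the arguments of
    \<omega>.\<close>
  have out: "t \<sigma> = 0" if "\<sigma> \<in> P - C" for \<sigma>
  proof -
    have \<sigma>: "\<sigma> permutes {..<1 + k}" using that by (simp add: P_def)
    have "\<sigma> 0 \<noteq> 0"
    proof
      assume "\<sigma> 0 = 0"
      then have "\<sigma> permutes {1..k}"
        by (intro permutes_superset[OF \<sigma>]) (auto simp: not_le less_Suc_eq_0_disj)
      then show False using that by (simp add: C_def)
    qed
    moreover obtain j where j: "\<sigma> j = 0" "j < 1 + k"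
      using permutes_in_image[OF \<sigma>] permutes_surj[OF \<sigma>] by (metis lessThan_iff surjD zero_less_Suc plus_1_eq_Suc)
    ultimately obtain m where "j = 1 + m" "m < k" by (cases j) auto
    then have "\<omega> (\<lambda>i. ?w (\<sigma> (1 + i))) = 0"
      using j by (intro contract_eq_0_imp[OF \<omega> x, of m]) auto
    then show ?thesis by (simp add: t_def)
  qed
  have inn: "t \<sigma> = a (\<lambda>_. x) * \<omega> v" if "\<sigma> \<in> C" for \<sigma>
  proof -
    have \<sigma>: "\<sigma> permutes {1..k}" using that by (simp add: C_def)
    \<comment> \<open>Reordering the arguments of \<omega> produces a second factor
      \<open>sign \<sigma>\<close>, and the two signs cancel.\<close>
    have "(\<lambda>u. \<omega> (\<lambda>i. u (1 + i))) (?w \<circ> \<sigma>) = of_int (sign \<sigma>) * (\<lambda>u. \<omega> (\<lambda>i. u (1 + i))) ?w"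
    proof (rule antisymmetric_permute[OF \<sigma>])
      fix u :: "nat \<Rightarrow> real ^ 'n" and i j assume ij: "i \<in> {1..k}" "j \<in> {1..k}" "i \<noteq> j"
      have "(\<lambda>m. (u \<circ> Transposition.transpose i j) (1 + m)) = (\<lambda>m. u (1 + m)) \<circ> Transposition.transpose (i - 1) (j - 1)"
        using ij by (auto simp: fun_eq_iff Transposition.transpose_def)
      then show "\<omega> (\<lambda>m. (u \<circ> Transposition.transpose i j) (1 + m)) = - \<omega> (\<lambda>i. u (1 + i))"
        using ij alternating_form_swap[OF \<omega>, of "i - 1" "j - 1" "\<lambda>i. u (1 + i)"] by fastforce
    qed simp
    then have "\<omega> (\<lambda>i. ?w (\<sigma> (1 + i))) = of_int (sign \<sigma>) * \<omega> v"
      by (simp add: o_def)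
    moreover have "a (\<lambda>i. ?w (\<sigma> i)) = a (\<lambda>_. x)"
      using C0[OF that] by (intro alternating_form_cong[OF a]) auto
    moreover have "of_int (sign \<sigma>) * of_int (sign \<sigma>) = (1::real)"
      by (metis of_int_1 of_int_mult sign_idempotent)
    ultimately show ?thesis by (simp add: t_def)
  qed
  have "finite P" by (simp add: P_def finite_permutations)
  then have "sum t P = sum t C"
    using out sub by (intro sum.mono_neutral_right) auto
  also have "\<dots> = real (card C) * (a (\<lambda>_. x) * \<omega> v)" using inn by simp
  also have "card C = fact k" unfolding C_def by (rule card_permutations) auto
  finally have "sum t P = fact k * (a (\<lambda>_. x) * \<omega> v)" by simp
  then show ?thesis unfolding wedge_def t_def[symmetric] P_def[symmetric] by simp
qed

text \<open>The wedge product and \<mu> are both multiples of the determinant, so their values at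
  (x, v) are in the same ratio as those on \<open>standard_frame\<close>. The identity is
  cross-multiplied to avoid any division.\<close>

lemma horizontal_form_proportional:
  fixes \<omega> a \<mu> :: "'n::{finite, linorder} alt_form" and x :: "real ^ 'n::{finite, linorder}"
  assumes \<omega>: "alternating_form k \<omega>" and a: "alternating_form 1 a" and x: "\<And>v. contract k x \<omega> v = 0"
    and \<mu>: "alternating_form CARD('n) \<mu>" and k: "CARD('n) = 1 + k"
  shows "a (\<lambda>_. x) * \<omega> v * \<mu> standard_frame = wedge 1 k a \<omega> standard_frame * \<mu> (case_nat x v)"
proof -
  have "alternating_form CARD('n) (wedge 1 k a \<omega>)"
    unfolding k by (rule alternating_form_wedge[OF a \<omega>])
  from top_form_eq_det[OF this, of "case_nat x v"] top_form_eq_det[OF \<mu>, of "case_nat x v"]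
  show ?thesis
    unfolding wedge_one_form_contract[OF \<omega> a x] by simp
qed

lemma smooth_on_wedge:
  assumes "open S" "\<And>v. smooth_on S (\<lambda>x. \<omega> x v)" "\<And>v. smooth_on S (\<lambda>x. \<eta> x v)"
  shows "smooth_on S (\<lambda>x. wedge k l (\<omega> x) (\<eta> x) v)"
  unfolding wedge_def
  by (intro smooth_on_divide smooth_on_sum smooth_on_mult smooth_on_const assms) simp

text \<open>The shape of the exterior derivative of a one-form at a point, with \<open>E u w\<close>
  the derivative in direction \<open>u\<close> of the form evaluated on the constant vector
  \<open>w\<close>.\<close>

lemma alternating_form_commutator:
  assumes "bilinear E"
  shows "alternating_form 2 (\<lambda>v. E (v 0) (v 1) - E (v 1) (v 0) :: real)"
proof -
  note E = bilinear_ladd[OF assms] bilinear_radd[OF assms] bilinear_lmul[OF assms] bilinear_rmul[OF assms]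
  show ?thesis
    unfolding alternating_form_def
    by (auto simp: less_2_cases_iff linear_iff E algebra_simps)
qed

section \<open>Exterior derivatives of one-forms\<close>

text \<open>The sum is the derivative of \<open>z \<mapsto> a z (L x)\<close> at \<open>T x\<close>, in coordinates.\<close>

lemma has_derivative_one_form:
  fixes a :: "'b::real_normed_vector \<Rightarrow> real ^ 'n \<Rightarrow> real" and T :: "'a::real_normed_vector \<Rightarrow> 'b"
  assumes U: "open U" "T x \<in> U"
    and a: "\<And>z. z \<in> U \<Longrightarrow> linear (a z)" "\<And>u. (\<lambda>z. a z u) differentiable at (T x)"
    and T: "(T has_derivative T') (at x)" and L: "(L has_derivative L') (at x)"
  shows "((\<lambda>y. a (T y) (L y)) has_derivative
    (\<lambda>w. a (T x) (L' w) + (\<Sum>k\<in>UNIV. L x $ k * frechet_derivative (\<lambda>z. a z (axis k 1)) (at (T x)) (T' w))))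
    (at x)"
proof -
  have expand: "a z u = (\<Sum>k\<in>UNIV. u $ k * a z (axis k 1))" if "z \<in> U" for z u
    using linear_axis_expansion[OF a(1)[OF that], of u] by simp
  have "((\<lambda>y. a (T y) (axis k 1)) has_derivative
      (\<lambda>w. frechet_derivative (\<lambda>z. a z (axis k 1)) (at (T x)) (T' w))) (at x)" for k
    using has_derivative_compose[OF T frechet_derivative_worksI[OF a(2)]] by simp
  moreover have "((\<lambda>y. L y $ k) has_derivative (\<lambda>w. L' w $ k)) (at x)" for k
    by (rule bounded_linear.has_derivative[OF bounded_linear_vec_nth L])
  ultimately have D: "((\<lambda>y. \<Sum>k\<in>UNIV. L y $ k * a (T y) (axis k 1)) has_derivative
      (\<lambda>w. \<Sum>k\<in>UNIV. L x $ k * frechet_derivative (\<lambda>z. a z (axis k 1)) (at (T x)) (T' w) + L' w $ k * a (T x) (axis k 1)))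
      (at x)"
    by (intro has_derivative_sum has_derivative_mult)
  \<comment> \<open>The basis expansion of \<open>a (T y)\<close> relies on linearity, which is
    available only in \<open>U\<close>; continuity of \<open>T\<close> keeps \<open>T y\<close>
    there for \<open>y\<close> near \<open>x\<close>.\<close>
  have "\<forall>\<^sub>F y in at x. T y \<in> U"
    using has_derivative_continuous[OF T] U unfolding continuous_within by (auto dest: topological_tendstoD)
  then have "\<forall>\<^sub>F y in at x. (\<Sum>k\<in>UNIV. L y $ k * a (T y) (axis k 1)) = a (T y) (L y)"
    by (rule eventually_mono) (simp add: expand[symmetric])
  from has_derivative_transform_eventually[OF D this]
  have "((\<lambda>y. a (T y) (L y)) has_derivative
      (\<lambda>w. \<Sum>k\<in>UNIV. L x $ k * frechet_derivative (\<lambda>z. a z (axis k 1)) (at (T x)) (T' w) + L' w $ k * a (T x) (axis k 1)))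
      (at x)"
    by (simp add: expand[OF U(2), symmetric])
  then show ?thesis
    by (simp add: sum.distrib expand[OF U(2), symmetric] add.commute)
qed

text \<open>Makes the derivative visibly linear in the vector \<open>u\<close>, by taking the
  identity for \<open>T\<close> and a constant \<open>L\<close>.\<close>

lemma frechet_derivative_one_form:
  fixes a :: "'b::real_normed_vector \<Rightarrow> real ^ 'n \<Rightarrow> real"
  assumes "open U" "x \<in> U" "\<And>z. z \<in> U \<Longrightarrow> linear (a z)" "\<And>u. (\<lambda>z. a z u) differentiable at x"
  shows "frechet_derivative (\<lambda>z. a z u) (at x) =
    (\<lambda>w. \<Sum>k\<in>UNIV. u $ k * frechet_derivative (\<lambda>z. a z (axis k 1)) (at x) w)"
  using frechet_derivative_at[OF has_derivative_one_form[OF assms(1) _ assms(3), where T="\<lambda>x. x" and x=x and L="\<lambda>_. u",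
      OF assms(2) _ assms(4) has_derivative_ident has_derivative_const], symmetric]
    linear_0[OF assms(3)[OF assms(2)]] by simp

text \<open>The mean value argument is for real values, so it is applied to each coordinate; the
  work is in moving coordinates through \<open>frechet_derivative\<close>.\<close>

lemma second_derivative_symmetric_vec:
  fixes T :: "'a::real_normed_vector \<Rightarrow> real ^ 'n"
  assumes S: "open S" "x \<in> S" and T: "smooth_on S T"
  shows "frechet_derivative (\<lambda>y. frechet_derivative T (at y) u) (at x) v =
    frechet_derivative (\<lambda>y. frechet_derivative T (at y) v) (at x) u"
proof (rule vec_eq_iff[THEN iffD2, rule_format])
  fix i
  have nth: "frechet_derivative (\<lambda>y. F y $ i) (at y) = (\<lambda>w. frechet_derivative F (at y) w $ i)"
    if "F differentiable at y" for F :: "'a \<Rightarrow> real ^ 'n" and y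
    using bounded_linear.has_derivative[OF bounded_linear_vec_nth frechet_derivative_worksI[OF that]]
    by (rule frechet_derivative_at[symmetric])
  have D: "frechet_derivative (\<lambda>y. frechet_derivative (\<lambda>z. T z $ i) (at y) a) (at x) b =
      frechet_derivative (\<lambda>y. frechet_derivative T (at y) a) (at x) b $ i" for a b
  proof -
    have d: "(\<lambda>y. frechet_derivative T (at y) a) differentiable at x"
      by (rule smooth_on_imp_differentiable[OF smooth_on_frechet_derivative[OF T] S(2)])
    have "((\<lambda>y. frechet_derivative T (at y) a $ i) has_derivative
        (\<lambda>w. frechet_derivative (\<lambda>y. frechet_derivative T (at y) a) (at x) w $ i)) (at x)"
      by (rule bounded_linear.has_derivative[OF bounded_linear_vec_nth frechet_derivative_worksI[OF d]])
    then have "((\<lambda>y. frechet_derivative (\<lambda>z. T z $ i) (at y) a) has_derivative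
        (\<lambda>w. frechet_derivative (\<lambda>y. frechet_derivative T (at y) a) (at x) w $ i)) (at x)"
      by (rule has_derivative_transform_within_open[OF _ S]) (simp add: nth smooth_on_imp_differentiable[OF T])
    from frechet_derivative_at[OF this] show ?thesis by metis
  qed
  show "frechet_derivative (\<lambda>y. frechet_derivative T (at y) u) (at x) v $ i =
      frechet_derivative (\<lambda>y. frechet_derivative T (at y) v) (at x) u $ i"
    unfolding D[symmetric] by (rule second_derivative_symmetric[OF S smooth_on_nth[OF S(1) T]])
qed

lemma flat_ext_deriv_1:
  assumes "\<And>y v. \<omega> y v = \<omega> y (\<lambda>_. v 0)"
  shows "flat_ext_deriv 1 \<omega> x v =
    frechet_derivative (\<lambda>y. \<omega> y (\<lambda>_. v 1)) (at x) (v 0) - frechet_derivative (\<lambda>y. \<omega> y (\<lambda>_. v 0)) (at x) (v 1)"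
proof -
  have "(\<lambda>y. \<omega> y (\<lambda>j. v (Suc j))) = (\<lambda>y. \<omega> y (\<lambda>_. v 1))"
    by (subst assms) simp
  moreover have "(\<lambda>y. \<omega> y (\<lambda>j. if j < 1 then v j else v (Suc j))) = (\<lambda>y. \<omega> y (\<lambda>_. v 0))"
    by (subst assms) simp
  ultimately show ?thesis
    by (simp add: flat_ext_deriv_def numeral_2_eq_2)
qed

section \<open>Charts\<close>

locale oriented_manifold =
  fixes A :: "('a::{t2_space, second_countable_topology}, 'n::{finite, linorder}) chart set"
  assumes oriented: "oriented_atlas A"
begin

definition overlap :: "('a, 'n) chart \<Rightarrow> ('a, 'n) chart \<Rightarrow> (real ^ 'n::{finite, linorder}) set" where
  "overlap c d = snd c ` (fst c \<inter> fst d)"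

text \<open>Common generalisation of \<open>to_chart\<close> and \<open>from_chart\<close>: their
  calculus follows from the cocycle rule \<open>trans_deriv_trans\<close> and from
  \<open>trans_deriv_refl\<close>.\<close>

definition trans_deriv :: "('a, 'n) chart \<Rightarrow> ('a, 'n) chart \<Rightarrow> 'a \<Rightarrow> real ^ 'n::{finite, linorder} \<Rightarrow> real ^ 'n::{finite, linorder}" where
  "trans_deriv c d p = frechet_derivative (transition c d) (at (snd c p))"

lemma
  assumes "c \<in> A"
  shows chart_open: "open (fst c)"
    and chart_image_open: "open (chart_image c)"
    and chart_homeomorphism: "homeomorphism (fst c) (chart_image c) (snd c) (chart_inv c)"
  using oriented assms by (auto simp: oriented_atlas_def smooth_atlas_def is_chart_def)

lemma chart_inv_apply [simp]: "c \<in> A \<Longrightarrow> p \<in> fst c \<Longrightarrow> chart_inv c (snd c p) = p"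
  using chart_homeomorphism homeomorphism_apply1 by blast

lemma apply_chart_inv [simp]: "c \<in> A \<Longrightarrow> x \<in> chart_image c \<Longrightarrow> snd c (chart_inv c x) = x"
  using chart_homeomorphism homeomorphism_apply2 by blast

lemma chart_inv_in [simp]: "c \<in> A \<Longrightarrow> x \<in> chart_image c \<Longrightarrow> chart_inv c x \<in> fst c"
  using chart_homeomorphism[of c] unfolding homeomorphism_def by blast

lemma chart_apply_in [simp]: "p \<in> fst c \<Longrightarrow> snd c p \<in> chart_image c"
  by (simp add: chart_image_def)

lemma continuous_on_chart_inv: "c \<in> A \<Longrightarrow> continuous_on (chart_image c) (chart_inv c)"
  using chart_homeomorphism[of c] unfolding homeomorphism_def by blast

lemma continuous_on_chart: "c \<in> A \<Longrightarrow> continuous_on (fst c) (snd c)"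
  using chart_homeomorphism[of c] unfolding homeomorphism_def by blast

lemma open_chart_preimage:
  assumes "c \<in> A" "open W"
  shows "open {x \<in> chart_image c. chart_inv c x \<in> W}"
proof -
  have "{x \<in> chart_image c. chart_inv c x \<in> W} = chart_image c \<inter> chart_inv c -` W" by auto
  then show ?thesis
    using continuous_open_preimage[OF continuous_on_chart_inv[OF assms(1)] chart_image_open[OF assms(1)] assms(2)]
    by simp
qed

lemma overlap_iff: "c \<in> A \<Longrightarrow> x \<in> overlap c d \<longleftrightarrow> x \<in> chart_image c \<and> chart_inv c x \<in> fst d"
  by (force simp: overlap_def chart_image_def)

lemma open_overlap:
  assumes "c \<in> A" "d \<in> A" shows "open (overlap c d)"
proof -
  have "overlap c d = {x \<in> chart_image c. chart_inv c x \<in> fst d}"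
    using overlap_iff[OF assms(1)] by blast
  then show ?thesis using open_chart_preimage[OF assms(1) chart_open[OF assms(2)]] by simp
qed

lemma smooth_on_transition: "c \<in> A \<Longrightarrow> d \<in> A \<Longrightarrow> smooth_on (overlap c d) (transition c d)"
  using oriented by (auto simp: oriented_atlas_def smooth_atlas_def overlap_def)

lemma transition_apply: "c \<in> A \<Longrightarrow> p \<in> fst c \<Longrightarrow> transition c d (snd c p) = snd d p"
  by (simp add: transition_def)

lemma
  shows chart_at_in [simp]: "chart_at A p \<in> A" and in_chart_at [simp]: "p \<in> fst (chart_at A p)"
proof -
  have "\<exists>c. c \<in> A \<and> p \<in> fst c"
    using oriented UNIV_I[of p] unfolding oriented_atlas_def smooth_atlas_def by blast
  from someI_ex[OF this] show "chart_at A p \<in> A" "p \<in> fst (chart_at A p)"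
    by (auto simp: chart_at_def)
qed

lemma has_derivative_transition:
  assumes "c \<in> A" "d \<in> A" "p \<in> fst c" "p \<in> fst d"
  shows "(transition c d has_derivative trans_deriv c d p) (at (snd c p))"
  unfolding trans_deriv_def
  using assms smooth_on_imp_differentiable[OF smooth_on_transition]
  by (intro frechet_derivative_worksI) (simp add: overlap_def)

lemma linear_trans_deriv:
  "c \<in> A \<Longrightarrow> d \<in> A \<Longrightarrow> p \<in> fst c \<Longrightarrow> p \<in> fst d \<Longrightarrow> linear (trans_deriv c d p)"
  using has_derivative_transition has_derivative_linear by blast

lemma trans_deriv_trans:
  assumes "c \<in> A" "d \<in> A" "e \<in> A" "p \<in> fst c" "p \<in> fst d" "p \<in> fst e"
  shows "trans_deriv d e p (trans_deriv c d p u) = trans_deriv c e p u"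
proof -
  have "((\<lambda>x. transition d e (transition c d x)) has_derivative (\<lambda>u. trans_deriv d e p (trans_deriv c d p u)))
      (at (snd c p))"
    using has_derivative_compose[OF has_derivative_transition[of c d p]] has_derivative_transition[of d e p]
      assms by (simp add: transition_apply)
  then have "(transition c e has_derivative (\<lambda>u. trans_deriv d e p (trans_deriv c d p u))) (at (snd c p))"
    by (rule has_derivative_transform_within_open[where s="overlap c d"])
      (use assms open_overlap in \<open>auto simp: overlap_def transition_apply\<close>)
  with has_derivative_transition[of c e p] show ?thesis
    using assms has_derivative_unique by metis
qed

lemma trans_deriv_refl:
  assumes "c \<in> A" "p \<in> fst c"
  shows "trans_deriv c c p u = u"
proof -
  have "(transition c c has_derivative (\<lambda>u. u)) (at (snd c p))"
    by (rule has_derivative_transform_within_open[OF has_derivative_ident chart_image_open[OF assms(1)]])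
      (use assms in \<open>auto simp: transition_def\<close>)
  with has_derivative_transition[of c c p] show ?thesis
    using assms has_derivative_unique by metis
qed

lemma det_trans_deriv:
  "c \<in> A \<Longrightarrow> d \<in> A \<Longrightarrow> p \<in> fst c \<Longrightarrow> p \<in> fst d \<Longrightarrow> det (matrix (trans_deriv c d p)) > 0"
  using oriented by (auto simp: oriented_atlas_def trans_deriv_def)

lemma to_chart_eq: "to_chart A c p = trans_deriv (chart_at A p) c p"
  by (simp add: to_chart_def trans_deriv_def)

lemma from_chart_eq: "from_chart A c p = trans_deriv c (chart_at A p) p"
  by (simp add: from_chart_def trans_deriv_def)

lemma linear_from_chart: "c \<in> A \<Longrightarrow> p \<in> fst c \<Longrightarrow> linear (from_chart A c p)"
  by (simp add: from_chart_eq linear_trans_deriv)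

lemma linear_to_chart: "c \<in> A \<Longrightarrow> p \<in> fst c \<Longrightarrow> linear (to_chart A c p)"
  by (simp add: to_chart_eq linear_trans_deriv)

lemma from_to_chart [simp]: "c \<in> A \<Longrightarrow> p \<in> fst c \<Longrightarrow> from_chart A c p (to_chart A c p u) = u"
  by (simp add: from_chart_eq to_chart_eq trans_deriv_trans trans_deriv_refl)

lemma to_from_chart:
  "c \<in> A \<Longrightarrow> d \<in> A \<Longrightarrow> p \<in> fst c \<Longrightarrow> p \<in> fst d \<Longrightarrow>
    to_chart A d p (from_chart A c p u) = trans_deriv c d p u"
  by (simp add: from_chart_eq to_chart_eq trans_deriv_trans)

lemma from_chart_trans_deriv:
  "c \<in> A \<Longrightarrow> d \<in> A \<Longrightarrow> p \<in> fst c \<Longrightarrow> p \<in> fst d \<Longrightarrow>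
    from_chart A d p (trans_deriv c d p u) = from_chart A c p u"
  by (simp add: from_chart_eq trans_deriv_trans)

lemma smooth_on_trans_deriv:
  assumes "c \<in> A" "d \<in> A"
  shows "smooth_on (overlap c d) (\<lambda>x. trans_deriv c d (chart_inv c x) u)"
  by (rule smooth_on_cong[OF open_overlap[OF assms]
        smooth_on_frechet_derivative[OF smooth_on_transition[OF assms], of u]])
    (use assms in \<open>simp add: trans_deriv_def overlap_iff\<close>)

section \<open>Vector fields and differential forms in a fixed chart\<close>

lemma local_form_apply:
  "c \<in> A \<Longrightarrow> p \<in> fst c \<Longrightarrow> local_form A c \<omega> (snd c p) v = \<omega> p (\<lambda>i. from_chart A c p (v i))"
  by (simp add: local_form_def)

lemma vector_field_local:
  "vector_field A X \<Longrightarrow> c \<in> A \<Longrightarrow> smooth_on (chart_image c) (local_vector_field A c X)"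
  by (simp add: vector_field_def)

lemma from_chart_local_vector_field:
  "c \<in> A \<Longrightarrow> x \<in> chart_image c \<Longrightarrow> from_chart A c (chart_inv c x) (local_vector_field A c X x) = X (chart_inv c x)"
  by (simp add: local_vector_field_def)

lemma diff_form_alternating: "diff_form A k \<omega> \<Longrightarrow> alternating_form k (\<omega> p)"
  by (simp add: diff_form_def)

lemma diff_form_smooth: "diff_form A k \<omega> \<Longrightarrow> c \<in> A \<Longrightarrow> smooth_on (chart_image c) (\<lambda>x. local_form A c \<omega> x v)"
  by (simp add: diff_form_def)

lemma one_form_eq: "diff_form A 1 \<alpha> \<Longrightarrow> \<alpha> p v = \<alpha> p (\<lambda>_. v 0)"
  by (rule alternating_form_cong[OF diff_form_alternating]) auto

lemma local_one_form_eq: "diff_form A 1 \<alpha> \<Longrightarrow> local_form A c \<alpha> x v = local_form A c \<alpha> x (\<lambda>_. v 0)"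
  unfolding local_form_def by (subst one_form_eq) auto

lemma linear_one_form: "diff_form A 1 \<alpha> \<Longrightarrow> linear (\<lambda>u. \<alpha> p (\<lambda>_. u))"
  using alternating_form_linear[OF diff_form_alternating, of 1 \<alpha> 0 p "\<lambda>_. 0"]
    one_form_eq[of \<alpha> p "(\<lambda>_. 0)(0 := _)"] by simp

lemma linear_local_one_form:
  assumes "diff_form A 1 \<alpha>" "c \<in> A" "x \<in> chart_image c"
  shows "linear (\<lambda>u. local_form A c \<alpha> x (\<lambda>_. u))"
  using linear_compose[OF linear_from_chart[OF assms(2) chart_inv_in[OF assms(2,3)]] linear_one_form[OF assms(1)]]
  by (simp add: local_form_def o_def)

lemma flat_ext_deriv_local:
  assumes "diff_form A 1 \<alpha>"
  shows "flat_ext_deriv 1 (local_form A c \<alpha>) x v =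
    frechet_derivative (\<lambda>y. local_form A c \<alpha> y (\<lambda>_. v 1)) (at x) (v 0) -
    frechet_derivative (\<lambda>y. local_form A c \<alpha> y (\<lambda>_. v 0)) (at x) (v 1)"
  by (rule flat_ext_deriv_1) (rule local_one_form_eq[OF assms])

text \<open>
  \<open>ext_deriv\<close> uses a different chart at every point; it is independent of the chart because the
  second derivative of the transition map is symmetric.
\<close>

lemma ext_deriv_local:
  assumes \<alpha>: "diff_form A 1 \<alpha>" and c: "c \<in> A" and x: "x \<in> chart_image c"
  shows "local_form A c (ext_deriv A 1 \<alpha>) x v = flat_ext_deriv 1 (local_form A c \<alpha>) x v"
proof -
  define p where "p = chart_inv c x"
  define b where "b = chart_at A p"
  define T where "T = transition c b"
  define a where "a d z u = local_form A d \<alpha> z (\<lambda>_. u)" for d z u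
  define D where "D = frechet_derivative T (at x)"
  have p: "p \<in> fst c" "snd c p = x" using c x by (auto simp: p_def)
  have b: "b \<in> A" "p \<in> fst b" by (auto simp: b_def)
  have S: "open (overlap c b)" "x \<in> overlap c b"
    using open_overlap c b p by (auto simp: overlap_def)
  have Tx: "T x = snd b p" using c p by (auto simp: T_def transition_apply)
  have smT: "smooth_on (overlap c b) T" unfolding T_def using c b by (intro smooth_on_transition)
  have DT: "(T has_derivative D) (at x)"
    unfolding D_def using smooth_on_imp_differentiable[OF smT S(2)] by (rule frechet_derivative_worksI)
  \<comment> \<open>In chart \<open>c\<close> the form is the pullback along \<open>T\<close> of its
    expression in chart \<open>b\<close>; \<open>b\<close> stays fixed while \<open>y\<close>
    varies.\<close>
  have eq: "a c y u = a b (T y) (frechet_derivative T (at y) u)" if "y \<in> overlap c b" for y u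
  proof -
    obtain q where q: "q \<in> fst c" "q \<in> fst b" "y = snd c q" using \<open>y \<in> overlap c b\<close> by (auto simp: overlap_def)
    have "frechet_derivative T (at y) = trans_deriv c b q"
      by (simp add: trans_deriv_def T_def q)
    then show ?thesis
      using c b q by (simp add: a_def local_form_apply T_def transition_apply from_chart_trans_deriv)
  qed
  have sm: "(\<lambda>z. a b z u) differentiable at (T x)" for u
    unfolding a_def using diff_form_smooth[OF \<alpha> b(1)] b Tx by (intro smooth_on_imp_differentiable[of "chart_image b"]) auto
  have lin: "linear (a b z)" if "z \<in> chart_image b" for z
  proof -
    have "a b z = (\<lambda>u. local_form A b \<alpha> z (\<lambda>_. u))" by (simp add: a_def fun_eq_iff)
    then show ?thesis using linear_local_one_form[OF \<alpha> b(1) that] by simp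
  qed
  have TxU: "T x \<in> chart_image b" using b Tx by simp
  have one: "frechet_derivative (\<lambda>z. a b z u) (at (T x)) w =
      (\<Sum>k\<in>UNIV. u $ k * frechet_derivative (\<lambda>z. a b z (axis k 1)) (at (T x)) w)" for u w
    by (rule frechet_derivative_one_form[OF chart_image_open[OF b(1)] TxU lin sm, THEN fun_cong])
  \<comment> \<open>Product rule for the pullback. The first term contains the second derivative of
    \<open>T\<close>; it is symmetric in \<open>u\<close> and \<open>w\<close> and cancels after
    antisymmetrisation. The second is the derivative in chart \<open>b\<close> on transported
    vectors.\<close>
  have key: "frechet_derivative (\<lambda>y. a c y u) (at x) w =
      a b (T x) (frechet_derivative (\<lambda>y. frechet_derivative T (at y) u) (at x) w) +
      frechet_derivative (\<lambda>z. a b z (D u)) (at (T x)) (D w)" for u w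
  proof -
    have "((\<lambda>y. frechet_derivative T (at y) u) has_derivative
        frechet_derivative (\<lambda>y. frechet_derivative T (at y) u) (at x)) (at x)"
      using smooth_on_imp_differentiable[OF smooth_on_frechet_derivative[OF smT] S(2)]
      by (rule frechet_derivative_worksI)
    from has_derivative_one_form[OF chart_image_open[OF b(1)] TxU lin sm DT this]
    have "((\<lambda>y. a b (T y) (frechet_derivative T (at y) u)) has_derivative
       (\<lambda>w. a b (T x) (frechet_derivative (\<lambda>y. frechet_derivative T (at y) u) (at x) w) +
          frechet_derivative (\<lambda>z. a b z (D u)) (at (T x)) (D w))) (at x)"
      unfolding one[symmetric] D_def[symmetric] .
    then have "((\<lambda>y. a c y u) has_derivative
       (\<lambda>w. a b (T x) (frechet_derivative (\<lambda>y. frechet_derivative T (at y) u) (at x) w) +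
          frechet_derivative (\<lambda>z. a b z (D u)) (at (T x)) (D w))) (at x)"
      by (rule has_derivative_transform_within_open[OF _ S]) (rule eq[symmetric])
    then show ?thesis by (rule frechet_derivative_at[THEN fun_cong, symmetric])
  qed
  have fc: "from_chart A c p = D"
    by (simp add: from_chart_eq trans_deriv_def b_def D_def T_def p)
  have "local_form A c (ext_deriv A 1 \<alpha>) x v = flat_ext_deriv 1 (local_form A b \<alpha>) (T x) (\<lambda>i. D (v i))"
    by (simp only: local_form_def[of A c "ext_deriv A 1 \<alpha>"] ext_deriv_def p_def[symmetric] b_def[symmetric] fc Tx)
  also have "\<dots> = frechet_derivative (\<lambda>z. a b z (D (v 1))) (at (T x)) (D (v 0)) -
      frechet_derivative (\<lambda>z. a b z (D (v 0))) (at (T x)) (D (v 1))"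
    unfolding a_def using flat_ext_deriv_local[OF \<alpha>] by simp
  also have "\<dots> = frechet_derivative (\<lambda>y. a c y (v 1)) (at x) (v 0) - frechet_derivative (\<lambda>y. a c y (v 0)) (at x) (v 1)"
    unfolding key using second_derivative_symmetric_vec[OF S smT, of "v 0" "v 1"] by simp
  also have "\<dots> = flat_ext_deriv 1 (local_form A c \<alpha>) x v"
    unfolding a_def using flat_ext_deriv_local[OF \<alpha>] by simp
  finally show ?thesis .
qed

lemma diff_form_ext_deriv:
  assumes \<alpha>: "diff_form A 1 \<alpha>"
  shows "diff_form A 2 (ext_deriv A 1 \<alpha>)"
  unfolding diff_form_def
proof (intro conjI allI ballI)
  fix p
  define b where "b = chart_at A p"
  define E where "E u w = frechet_derivative (\<lambda>z. local_form A b \<alpha> z (\<lambda>_. w)) (at (snd b p)) u" for u w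
  have b: "b \<in> A" "snd b p \<in> chart_image b" by (auto simp: b_def)
  have d: "(\<lambda>z. local_form A b \<alpha> z (\<lambda>_. w)) differentiable at (snd b p)" for w
    using diff_form_smooth[OF \<alpha> b(1)] b(2) by (rule smooth_on_imp_differentiable)
  \<comment> \<open>Linearity in the direction \<open>u\<close> comes with the derivative; linearity
    in the argument \<open>w\<close> has to be read off from this expansion.\<close>
  have "E u w = (\<Sum>k\<in>UNIV. w $ k * E u (axis k 1))" for u w
    using frechet_derivative_one_form[OF chart_image_open[OF b(1)] b(2) linear_local_one_form[OF \<alpha> b(1)] d]
    unfolding E_def by metis
  then have "\<exists>g. \<forall>w. E u w = (\<Sum>k\<in>UNIV. w $ k * g k)" for u by metis
  then obtain g where g: "\<And>u w. E u w = (\<Sum>k\<in>UNIV. w $ k * g u k)" by metis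
  have lin2: "linear (E u)" for u
    by (rule linearI) (simp_all add: g distrib_right sum.distrib sum_distrib_left mult.assoc)
  have lin1: "linear (\<lambda>u. E u w)" for w
    unfolding E_def using d by (intro linear_frechet_derivative)
  have "ext_deriv A 1 \<alpha> p = (\<lambda>v. E (v 0) (v 1) - E (v 1) (v 0))"
    using flat_ext_deriv_local[OF \<alpha>]
    by (simp add: ext_deriv_def E_def b_def fun_eq_iff)
  moreover have "bilinear E" using lin1 lin2 by (simp add: bilinear_def)
  ultimately show "alternating_form 2 (ext_deriv A 1 \<alpha> p)"
    using alternating_form_commutator by simp
next
  fix c v assume c: "c \<in> A"
  \<comment> \<open>Chart independence allows the whole of \<open>chart_image c\<close> to be
    treated in the single chart \<open>c\<close>.\<close>
  have "smooth_on (chart_image c) (\<lambda>x. flat_ext_deriv 1 (local_form A c \<alpha>) x v)"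
    unfolding flat_ext_deriv_local[OF \<alpha>]
    using diff_form_smooth[OF \<alpha> c]
    by (intro smooth_on_diff smooth_on_frechet_derivative chart_image_open[OF c]) auto
  then show "smooth_on (chart_image c) (\<lambda>x. local_form A c (ext_deriv A 1 \<alpha>) x v)"
    by (rule smooth_on_cong[OF chart_image_open[OF c]]) (rule ext_deriv_local[OF \<alpha> c, symmetric])
qed

lemma diff_form_wedge:
  assumes "diff_form A k \<omega>" "diff_form A l \<eta>"
  shows "diff_form A (k + l) (\<lambda>p. wedge k l (\<omega> p) (\<eta> p))"
  unfolding diff_form_def
proof (intro conjI allI ballI)
  show "alternating_form (k + l) (wedge k l (\<omega> p) (\<eta> p))" for p
    using assms by (intro alternating_form_wedge diff_form_alternating)
  fix c v assume c: "c \<in> A"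
  have "smooth_on (chart_image c) (\<lambda>x. wedge k l (local_form A c \<omega> x) (local_form A c \<eta> x) v)"
    using assms c by (intro smooth_on_wedge chart_image_open diff_form_smooth)
  then show "smooth_on (chart_image c) (\<lambda>x. local_form A c (\<lambda>p. wedge k l (\<omega> p) (\<eta> p)) x v)"
    by (simp add: local_form_def wedge_def)
qed

lemma diff_form_wedge_power:
  assumes "diff_form A k \<omega>"
  shows "diff_form A (k * m) (\<lambda>p. wedge_power k (\<omega> p) m)"
proof (induction m)
  case 0
  show ?case by (simp add: diff_form_def alternating_form_def local_form_def smooth_on_const)
next
  case (Suc m)
  then show ?case using diff_form_wedge[OF assms] by simp
qed

end

section \<open>Existence of a Riemannian metric\<close>

lemma smooth_step_nonneg: "smooth_step m x \<ge> 0"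
  by (simp add: smooth_step_def)

lemma smooth_step_pos: "x > 0 \<Longrightarrow> smooth_step m x > 0"
  by (simp add: smooth_step_def)

lemma smooth_step_eq_0: "x \<le> 0 \<Longrightarrow> smooth_step m x = 0"
  by (simp add: smooth_step_def)

lemma smooth_on_smooth_step_compose:
  "open S \<Longrightarrow> smooth_on S f \<Longrightarrow> smooth_on S (\<lambda>x. smooth_step m (f x))"
  using smooth_on_compose[OF _ _ open_UNIV smooth_on_smooth_step] by simp

context oriented_manifold
begin

lemma smooth_functionI:
  "(\<And>c. c \<in> A \<Longrightarrow> smooth_on (chart_image c) (\<lambda>x. f (chart_inv c x))) \<Longrightarrow> smooth_function A f"
  by (simp add: smooth_function_def o_def)

lemma smooth_functionD:
  "smooth_function A f \<Longrightarrow> c \<in> A \<Longrightarrow> smooth_on (chart_image c) (\<lambda>x. f (chart_inv c x))"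
  by (simp add: smooth_function_def o_def)

lemma smooth_function_continuous:
  assumes "smooth_function A f" shows "continuous_on UNIV f"
proof (rule continuous_at_imp_continuous_on, rule ballI)
  fix p
  define c where "c = chart_at A p"
  have c: "c \<in> A" "p \<in> fst c" by (simp_all add: c_def)
  have "continuous_on (fst c) (\<lambda>q. f (chart_inv c (snd c q)))"
    by (rule continuous_on_compose2[OF smooth_on_imp_continuous_on[OF smooth_functionD[OF assms c(1)]]
          continuous_on_chart[OF c(1)]]) auto
  then have "continuous_on (fst c) f"
    by (rule continuous_on_eq) (simp add: c)
  then show "isCont f p"
    using c(2) by (simp add: continuous_on_eq_continuous_at[OF chart_open[OF c(1)]])
qed

text \<open>A smooth step of r^2 - |y|^2 in coordinates centred at p. The support lies in the image
  K of a closed ball; K is compact, hence closed in a Hausdorff space, so a point outside the chart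
  has the complement of K as a neighbourhood where the extension by zero vanishes.\<close>

lemma bump_function:
  "\<exists>\<phi> K. smooth_function A \<phi> \<and> (\<forall>q. \<phi> q \<ge> 0) \<and> \<phi> p > 0 \<and>
     closed K \<and> K \<subseteq> fst (chart_at A p) \<and> (\<forall>q. q \<notin> K \<longrightarrow> \<phi> q = 0)"
proof -
  define c where "c = chart_at A p"
  have c: "c \<in> A" "p \<in> fst c" by (simp_all add: c_def)
  obtain r where r: "r > 0" "cball (snd c p) r \<subseteq> chart_image c"
    using open_contains_cball[of "chart_image c"] chart_image_open[OF c(1)] chart_apply_in[OF c(2)] by blast
  define \<phi> where "\<phi> q = (if q \<in> fst c then
      smooth_step 0 (r ^ 2 - (snd c q - snd c p) \<bullet> (snd c q - snd c p)) else 0)" for q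
  define K where "K = chart_inv c ` cball (snd c p) r"
  have "compact K"
    unfolding K_def using r by (intro compact_continuous_image compact_cball
        continuous_on_subset[OF continuous_on_chart_inv[OF c(1)]])
  then have K: "closed K" by (rule compact_imp_closed)
  have Kc: "K \<subseteq> fst c" unfolding K_def using r c by auto
  have out: "\<phi> q = 0" if "q \<notin> K" for q
  proof (cases "q \<in> fst c")
    case True
    have "snd c q \<notin> cball (snd c p) r"
    proof
      assume "snd c q \<in> cball (snd c p) r"
      then have "chart_inv c (snd c q) \<in> K" unfolding K_def by blast
      then show False using True c that by simp
    qed
    then have "r < norm (snd c q - snd c p)" by (simp add: dist_norm norm_minus_commute)
    then have "r ^ 2 \<le> (snd c q - snd c p) \<bullet> (snd c q - snd c p)"
      unfolding power2_norm_eq_inner[symmetric] using r by (intro power_mono) auto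
    then show ?thesis by (simp add: \<phi>_def smooth_step_eq_0)
  qed (simp add: \<phi>_def)
  have "smooth_function A \<phi>"
  proof (rule smooth_functionI, rule smooth_on_local)
    fix d assume d: "d \<in> A"
    show "open (chart_image d)" using d by (rule chart_image_open)
    fix x assume x: "x \<in> chart_image d"
    show "\<exists>U. open U \<and> x \<in> U \<and> smooth_on U (\<lambda>x. \<phi> (chart_inv d x))"
    proof (cases "chart_inv d x \<in> fst c")
      case True
      note o = open_overlap[OF d c(1)]
      have "smooth_on (overlap d c)
          (\<lambda>y. smooth_step 0 (r ^ 2 - (transition d c y - snd c p) \<bullet> (transition d c y - snd c p)))"
        by (intro smooth_on_smooth_step_compose smooth_on_diff smooth_on_inner smooth_on_const
            smooth_on_transition o d c)
      then have "smooth_on (overlap d c) (\<lambda>x. \<phi> (chart_inv d x))"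
        by (rule smooth_on_cong[OF o]) (use d in \<open>simp add: overlap_iff \<phi>_def transition_def\<close>)
      then show ?thesis using o True x d overlap_iff by blast
    next
      case False
      define U where "U = {y \<in> chart_image d. chart_inv d y \<in> - K}"
      have U: "open U" unfolding U_def using K d by (intro open_chart_preimage) auto
      have "smooth_on U (\<lambda>x. \<phi> (chart_inv d x))"
        by (rule smooth_on_cong[OF U smooth_on_const[of _ 0]]) (simp add: U_def out)
      then show ?thesis using U False x Kc by (auto simp: U_def)
    qed
  qed
  moreover have "\<phi> q \<ge> 0" for q by (simp add: \<phi>_def smooth_step_nonneg)
  moreover have "\<phi> p > 0" using c r by (simp add: \<phi>_def smooth_step_pos)
  ultimately show ?thesis using K Kc out unfolding c_def by blast
qed

text \<open>The sets where the bump functions are positive form an open cover, which by second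
  countability has a countable subcover. The enumeration of the centres may have
  repetitions.\<close>

lemma countable_bump_functions:
  "\<exists>(c :: nat \<Rightarrow> ('a, 'n) chart) \<psi> K. (\<forall>k. c k \<in> A \<and> smooth_function A (\<psi> k) \<and> (\<forall>q. \<psi> k q \<ge> 0) \<and>
     closed (K k) \<and> K k \<subseteq> fst (c k) \<and> (\<forall>q. q \<notin> K k \<longrightarrow> \<psi> k q = 0)) \<and> (\<forall>q. \<exists>k. \<psi> k q > 0)"
proof -
  obtain \<phi> K where \<phi>: "\<And>p. smooth_function A (\<phi> p) \<and> (\<forall>q. \<phi> p q \<ge> 0) \<and> \<phi> p p > 0 \<and>
     closed (K p) \<and> K p \<subseteq> fst (chart_at A p) \<and> (\<forall>q. q \<notin> K p \<longrightarrow> \<phi> p q = 0)"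
    using bump_function by metis
  define U where "U p = {q. 0 < \<phi> p q}" for p
  have "open S" if "S \<in> range U" for S
    using that \<phi> smooth_function_continuous
    by (auto simp: U_def intro!: open_Collect_less continuous_on_const)
  then obtain F where F: "F \<subseteq> range U" "countable F" "\<Union> F = \<Union> (range U)"
    using Lindelof[of "range U"] by metis
  obtain P where P: "countable P" "F = U ` P"
    using F countable_subset_image by metis
  have cover: "\<exists>p\<in>P. q \<in> U p" for q
  proof -
    have "q \<in> \<Union> (range U)" using \<phi>[of q] by (auto simp: U_def)
    then show ?thesis using F P by auto
  qed
  define e where "e = from_nat_into P"
  have "P \<noteq> {}" using cover by blast
  then have "range e = P" using P by (simp add: e_def range_from_nat_into)
  then have "\<exists>k. \<phi> (e k) q > 0" for q
    using cover[of q] by (auto simp: U_def)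
  then show ?thesis
    using \<phi> by (intro exI[of _ "\<lambda>k. chart_at A (e k)"] exI[of _ "\<lambda>k. \<phi> (e k)"] exI[of _ "\<lambda>k. K (e k)"]) simp
qed

text \<open>
  Multiplying \<open>\<psi>\<^sub>k\<close> by the factors \<open>smooth_step (1 / (k + 1) - \<psi>\<^sub>i)\<close> for \<open>i < k\<close> makes the family
  locally finite: near a point with \<open>\<psi>\<^sub>i > 0\<close>, these factors vanish for all large \<open>k\<close>.
\<close>

lemma locally_finite_bump_functions:
  "\<exists>(c :: nat \<Rightarrow> ('a, 'n) chart) \<rho> K. (\<forall>k. c k \<in> A \<and> smooth_function A (\<rho> k) \<and> (\<forall>q. \<rho> k q \<ge> 0) \<and>
     closed (K k) \<and> K k \<subseteq> fst (c k) \<and> (\<forall>q. q \<notin> K k \<longrightarrow> \<rho> k q = 0)) \<and> (\<forall>q. \<exists>k. \<rho> k q > 0) \<and>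
     (\<forall>p. \<exists>U N. open U \<and> p \<in> U \<and> (\<forall>k\<ge>N. \<forall>q\<in>U. \<rho> k q = 0))"
proof -
  obtain c :: "nat \<Rightarrow> ('a, 'n) chart" and \<psi> K where \<psi>': "\<forall>k. c k \<in> A \<and> smooth_function A (\<psi> k) \<and> (\<forall>q. \<psi> k q \<ge> 0) \<and>
     closed (K k) \<and> K k \<subseteq> fst (c k) \<and> (\<forall>q. q \<notin> K k \<longrightarrow> \<psi> k q = 0)" and pos': "\<forall>q. \<exists>k. \<psi> k q > 0"
    using countable_bump_functions by (elim exE conjE) (erule (1) that)
  note \<psi> = spec[OF \<psi>'] and pos = spec[OF pos']
  define \<rho> where "\<rho> k q = \<psi> k q * (\<Prod>i<k. smooth_step 0 (1 / real (Suc k) - \<psi> i q))" for k :: nat and q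
  have "smooth_function A (\<rho> k)" for k
  proof (rule smooth_functionI)
    fix d assume d: "d \<in> A"
    have sm: "smooth_on (chart_image d) (\<lambda>x. \<psi> i (chart_inv d x))" for i
      using \<psi>[of i] d by (intro smooth_functionD) simp_all
    show "smooth_on (chart_image d) (\<lambda>x. \<rho> k (chart_inv d x))"
      unfolding \<rho>_def
      by (intro smooth_on_mult sm smooth_on_prod smooth_on_smooth_step_compose smooth_on_diff
          smooth_on_const chart_image_open d)
  qed
  moreover have "\<rho> k q \<ge> 0" for k q
    unfolding \<rho>_def using \<psi> by (intro mult_nonneg_nonneg prod_nonneg) (auto simp: smooth_step_nonneg)
  moreover have "\<rho> k q = 0" if "q \<notin> K k" for k q
    using that \<psi> by (simp add: \<rho>_def)
  moreover have "\<exists>k. \<rho> k q > 0" for q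
  proof -
    \<comment> \<open>For the first function positive at \<open>q\<close> all earlier ones vanish
      there, so each damping factor is a step evaluated at 1 / (k + 1) > 0.\<close>
    define k where "k = (LEAST k. \<psi> k q > 0)"
    have k: "\<psi> k q > 0" unfolding k_def using pos[of q] by (rule LeastI_ex)
    have "\<psi> i q = 0" if "i < k" for i
      using not_less_Least[OF that[unfolded k_def]] \<psi>[of i] by (simp add: not_less antisym)
    then have "\<rho> k q > 0"
      unfolding \<rho>_def using k by (intro mult_pos_pos prod_pos) (auto simp: smooth_step_pos)
    then show ?thesis by blast
  qed
  moreover have "\<exists>U N. open U \<and> p \<in> U \<and> (\<forall>k\<ge>N. \<forall>q\<in>U. \<rho> k q = 0)" for p
  proof -
    obtain j where j: "\<psi> j p > 0" using pos by blast
    \<comment> \<open>On this set \<psi>_j has a positive lower bound. As soon as 1 / (k + 1) is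
      below it and \<open>k > j\<close>, the factor with \<open>i = j\<close> is zero.\<close>
    define U where "U = {q. \<psi> j p / 2 < \<psi> j q}"
    have "open U" unfolding U_def
      using \<psi> by (intro open_Collect_less continuous_on_const smooth_function_continuous) auto
    obtain M where M: "inverse (real (Suc M)) < \<psi> j p / 2"
      using reals_Archimedean[of "\<psi> j p / 2"] j by auto
    have "\<rho> k q = 0" if k: "k \<ge> max (Suc j) M" and q: "q \<in> U" for k q
    proof -
      have "1 / real (Suc k) \<le> inverse (real (Suc M))"
        using k by (simp add: field_simps)
      then have "1 / real (Suc k) - \<psi> j q \<le> 0" using M q by (simp add: U_def)
      then have "smooth_step 0 (1 / real (Suc k) - \<psi> j q) = 0" by (rule smooth_step_eq_0)
      moreover have "j < k" using k by simp
      ultimately have "(\<Prod>i<k. smooth_step 0 (1 / real (Suc k) - \<psi> i q)) = 0"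
        by (intro prod_zero) auto
      then show ?thesis by (simp add: \<rho>_def)
    qed
    then show ?thesis using \<open>open U\<close> j by (intro exI[of _ U] exI[of _ "max (Suc j) M"]) (auto simp: U_def)
  qed
  ultimately show ?thesis
    using \<psi> by (intro exI[of _ c] exI[of _ \<rho>] exI[of _ K]) blast
qed

text \<open>Weighted Euclidean inner products of the charts are added up: all terms are nonnegative
  on the diagonal, and at each point at least one of them is positive definite.\<close>

lemma riemannian_metric_exists: "\<exists>h. riemannian_metric A h"
proof -
  obtain c :: "nat \<Rightarrow> ('a, 'n) chart" and \<rho> K where \<rho>': "\<forall>k. c k \<in> A \<and> smooth_function A (\<rho> k) \<and> (\<forall>q. \<rho> k q \<ge> 0) \<and>
     closed (K k) \<and> K k \<subseteq> fst (c k) \<and> (\<forall>q. q \<notin> K k \<longrightarrow> \<rho> k q = 0)"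
    and pos': "\<forall>q. \<exists>k. \<rho> k q > 0"
    and fin': "\<forall>p. \<exists>U N. open U \<and> p \<in> U \<and> (\<forall>k\<ge>N. \<forall>q\<in>U. \<rho> k q = 0)"
    using locally_finite_bump_functions by (elim exE conjE) (erule (2) that)
  note \<rho> = spec[OF \<rho>'] and pos = spec[OF pos'] and fin = spec[OF fin']
  define t where "t k p u v = \<rho> k p * (to_chart A (c k) p u \<bullet> to_chart A (c k) p v)" for k :: nat and p u v
  \<comment> \<open>The series has finitely many nonzero terms near each point; writing it as
    infinite avoids a choice of \<open>N\<close> that would depend on the point.\<close>
  define h where "h p u v = (\<Sum>k. t k p u v)" for p u v
  have h_eq: "h q u v = (\<Sum>k<N. t k q u v)" if "\<forall>k\<ge>N. \<rho> k q = 0" for q u v N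
    unfolding h_def by (rule suminf_finite) (use that in \<open>auto simp: t_def not_less\<close>)
  \<comment> \<open>Outside the domain of \<open>c k\<close> the map \<open>to_chart\<close> has no
    meaning; there the weight is zero.\<close>
  have supp: "p \<in> fst (c k)" if "\<rho> k p \<noteq> 0" for k p
    using \<rho>[of k] that by blast
  have t_lin: "linear (t k p u)" for k p u
  proof (cases "\<rho> k p = 0")
    case True
    then have "t k p u = (\<lambda>v. 0)" by (simp add: t_def fun_eq_iff)
    then show ?thesis by (simp add: linear_zero)
  next
    case False
    have L: "linear (to_chart A (c k) p)" using \<rho> supp[OF False] by (intro linear_to_chart) auto
    show ?thesis
      by (rule linearI) (simp_all add: t_def linear_add[OF L] linear_scale[OF L] inner_add_right distrib_left)
  qed
  have t_sym: "t k p u v = t k p v u" for k p u v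
    by (simp add: t_def inner_commute)
  have h_sym: "h p u v = h p v u" for p u v
    by (simp add: h_def t_sym[of _ p u v])
  have h_lin: "linear (h p u)" for p u
  proof -
    obtain N where N: "\<forall>k\<ge>N. \<rho> k p = 0" using fin[of p] by blast
    have "h p u = (\<lambda>v. \<Sum>k<N. t k p u v)" using h_eq[OF N] by blast
    then show ?thesis using t_lin by (simp add: linear_compose_sum)
  qed
  have h_pos: "h p u u > 0" if "u \<noteq> 0" for p u
  proof -
    obtain N where N: "\<forall>k\<ge>N. \<rho> k p = 0" using fin[of p] by blast
    obtain k where k: "\<rho> k p > 0" using pos by blast
    then have kN: "k < N" using N by (metis less_irrefl not_less)
    have kA: "c k \<in> A" "p \<in> fst (c k)" using \<rho> supp[of k p] k by auto
    have "to_chart A (c k) p u \<noteq> 0"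
      using from_to_chart[OF kA, of u] linear_0[OF linear_from_chart[OF kA]] that by auto
    then have "t k p u u > 0" using k by (simp add: t_def)
    moreover have "t i p u u \<ge> 0" for i using \<rho>[of i] by (simp add: t_def)
    ultimately have "(\<Sum>k<N. t k p u u) > 0" using kN by (intro sum_pos2[of _ k]) auto
    then show ?thesis using h_eq[OF N] by simp
  qed
  have t_smooth: "smooth_on (chart_image d)
      (\<lambda>x. t k (chart_inv d x) (from_chart A d (chart_inv d x) u) (from_chart A d (chart_inv d x) v))"
    (is "smooth_on _ ?f") if d: "d \<in> A" for d k u v
  proof (rule smooth_on_local[OF chart_image_open[OF d]])
    fix x assume x: "x \<in> chart_image d"
    have ck: "c k \<in> A" "closed (K k)" "K k \<subseteq> fst (c k)" using \<rho> by auto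
    show "\<exists>U. open U \<and> x \<in> U \<and> smooth_on U ?f"
    proof (cases "chart_inv d x \<in> fst (c k)")
      case True
      note o = open_overlap[OF d ck(1)]
      have "overlap d (c k) \<subseteq> chart_image d" using overlap_iff[OF d] by blast
      then have "smooth_on (overlap d (c k)) (\<lambda>x. \<rho> k (chart_inv d x) *
          (trans_deriv d (c k) (chart_inv d x) u \<bullet> trans_deriv d (c k) (chart_inv d x) v))"
        using \<rho> by (intro smooth_on_mult smooth_on_inner o smooth_on_trans_deriv d ck
            smooth_on_subset[OF smooth_functionD[OF _ d]]) auto
      then have "smooth_on (overlap d (c k)) ?f"
        by (rule smooth_on_cong[OF o]) (use d ck in \<open>simp add: t_def overlap_iff to_from_chart\<close>)
      then show ?thesis using o True x d overlap_iff by blast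
    next
      case False
      define U where "U = {y \<in> chart_image d. chart_inv d y \<in> - K k}"
      have U: "open U" unfolding U_def using ck d by (intro open_chart_preimage) auto
      have "smooth_on U ?f"
        by (rule smooth_on_cong[OF U smooth_on_const[of _ 0]]) (use \<rho> in \<open>simp add: U_def t_def\<close>)
      then show ?thesis using U False x ck by (auto simp: U_def)
    qed
  qed
  have "smooth_on (chart_image d)
      (\<lambda>x. h (chart_inv d x) (from_chart A d (chart_inv d x) u) (from_chart A d (chart_inv d x) v))"
    (is "smooth_on _ ?f") if d: "d \<in> A" for d u v
  proof (rule smooth_on_local[OF chart_image_open[OF d]])
    fix x assume x: "x \<in> chart_image d"
    obtain U N where U: "open U" "chart_inv d x \<in> U" "\<forall>k\<ge>N. \<forall>q\<in>U. \<rho> k q = 0"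
      using fin[of "chart_inv d x"] by blast
    define V where "V = {y \<in> chart_image d. chart_inv d y \<in> U}"
    have V: "open V" unfolding V_def by (rule open_chart_preimage[OF d U(1)])
    have "smooth_on V (\<lambda>x. \<Sum>k<N. t k (chart_inv d x)
        (from_chart A d (chart_inv d x) u) (from_chart A d (chart_inv d x) v))"
      by (intro smooth_on_sum V smooth_on_subset[OF t_smooth[OF d]]) (auto simp: V_def)
    then have "smooth_on V ?f"
      by (rule smooth_on_cong[OF V]) (use U(3) in \<open>auto simp: V_def intro!: h_eq[symmetric]\<close>)
    then show "\<exists>U. open U \<and> x \<in> U \<and> smooth_on U ?f"
      using V x U(2) by (auto simp: V_def)
  qed
  moreover have "bilinear (h p)" for p
    using h_lin[of p] h_sym[of p] by (simp add: bilinear_def)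
  ultimately have "riemannian_metric A h"
    using h_sym h_pos by (simp add: riemannian_metric_def)
  then show ?thesis by (rule exI[of _ h])
qed

end

section \<open>Gram determinants\<close>

definition gram :: "(real ^ 'n \<Rightarrow> real ^ 'n \<Rightarrow> real) \<Rightarrow> real ^ 'n ^ 'n" where
  "gram B = (\<chi> i j. B (axis i 1) (axis j 1))"

lemma smooth_on_det:
  fixes M :: "'a::real_normed_vector \<Rightarrow> real ^ 'n ^ 'n"
  assumes "open S" "\<And>i j. smooth_on S (\<lambda>x. M x $ i $ j)"
  shows "smooth_on S (\<lambda>x. det (M x))"
  unfolding det_def by (intro smooth_on_sum smooth_on_mult smooth_on_const smooth_on_prod assms)

lemma bilinear_gram:
  assumes "bilinear B"
  shows "B u v = (\<Sum>i\<in>UNIV. \<Sum>j\<in>UNIV. u $ i * v $ j * gram B $ i $ j)"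
proof -
  have 1: "linear (\<lambda>u. B u v)" for v using assms by (auto simp: bilinear_def)
  have 2: "linear (B u)" for u using assms by (auto simp: bilinear_def)
  have "B u v = (\<Sum>i\<in>UNIV. u $ i *\<^sub>R B (axis i 1) v)"
    by (rule linear_axis_expansion[OF 1])
  also have "\<dots> = (\<Sum>i\<in>UNIV. u $ i *\<^sub>R (\<Sum>j\<in>UNIV. v $ j *\<^sub>R B (axis i 1) (axis j 1)))"
    by (intro sum.cong refl arg_cong[where f="(*\<^sub>R) _"] linear_axis_expansion[OF 2])
  finally show ?thesis by (simp add: gram_def sum_distrib_left mult.assoc)
qed

text \<open>The transformation rule behind all volume computations below: changes of chart,
  orthonormal frames and the rescaling along the kernel are each treated as a pullback.\<close>

lemma det_gram_linear:
  assumes "bilinear B" "linear P"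
  shows "det (gram (\<lambda>u v. B (P u) (P v))) = (det (matrix P))\<^sup>2 * det (gram B)"
proof -
  have "gram (\<lambda>u v. B (P u) (P v)) = transpose (matrix P) ** (gram B ** matrix P)"
    unfolding vec_eq_iff
  proof (intro allI)
    fix i j
    show "gram (\<lambda>u v. B (P u) (P v)) $ i $ j = (transpose (matrix P) ** (gram B ** matrix P)) $ i $ j"
      by (simp add: gram_def[of "\<lambda>u v. B (P u) (P v)"] bilinear_gram[OF assms(1), of "P (axis i 1)"]
          matrix_matrix_mult_def transpose_def matrix_def sum_distrib_left mult_ac)
  qed
  then show ?thesis by (simp add: det_mul det_transpose power2_eq_square)
qed

text \<open>The segment from the identity matrix to \<open>gram B\<close> consists of invertible matrices.\<close>

lemma det_gram_pos:
  fixes B :: "real ^ 'n \<Rightarrow> real ^ 'n \<Rightarrow> real"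
  assumes B: "bilinear B" and pos: "\<And>u. u \<noteq> 0 \<Longrightarrow> B u u > 0"
  shows "det (gram B) > 0"
proof (rule ccontr)
  assume neg: "\<not> det (gram B) > 0"
  define M where "M t = (\<chi> i j. (1 - t) * (if i = j then 1 else 0) + t * gram B $ i $ j)" for t :: real
  have "det (M t) \<noteq> 0" if t: "0 \<le> t" "t \<le> 1" for t
  proof -
    have "x = 0" if "M t *v x = 0" for x
    proof (rule ccontr)
      assume x: "x \<noteq> 0"
      define Q where "Q i = (\<Sum>j\<in>UNIV. gram B $ i $ j * x $ j)" for i
      have "(\<Sum>j\<in>UNIV. M t $ i $ j * x $ j) = (1 - t) * x $ i + t * Q i" for i
      proof -
        have "(\<Sum>j\<in>UNIV. M t $ i $ j * x $ j) =
          (\<Sum>j\<in>UNIV. (1 - t) * (if i = j then x $ j else 0) + t * (gram B $ i $ j * x $ j))"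
          by (intro sum.cong refl) (simp add: M_def algebra_simps)
        then show ?thesis by (simp add: sum.distrib sum_distrib_left[symmetric] Q_def)
      qed
      then have "(1 - t) * x $ i + t * Q i = 0" for i
        using that by (simp add: matrix_vector_mult_def vec_eq_iff)
      \<comment> \<open>Pairing the equation with \<open>x\<close> leaves a convex combination of
        the positive numbers x \<bullet> x and \<open>B x x\<close>.\<close>
      then have "0 = (\<Sum>i\<in>UNIV. x $ i * ((1 - t) * x $ i + t * Q i))" by simp
      also have "\<dots> = (1 - t) * (\<Sum>i\<in>UNIV. x $ i * x $ i) + t * (\<Sum>i\<in>UNIV. x $ i * Q i)"
        by (simp add: sum_distrib_left distrib_left sum.distrib mult_ac)
      also have "(\<Sum>i\<in>UNIV. x $ i * Q i) = B x x"
        by (simp add: bilinear_gram[OF B, of x x] Q_def sum_distrib_left mult_ac)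
      finally have "(1 - t) * (x \<bullet> x) + t * B x x = 0"
        by (simp add: inner_vec_def)
      moreover have "(1 - t) * (x \<bullet> x) + t * B x x > 0"
      proof (cases "t = 0")
        case False
        then have "t * B x x > 0" using pos[OF x] t by simp
        then show ?thesis using t by (intro add_nonneg_pos) auto
      qed (use x in simp)
      ultimately show False by simp
    qed
    then show ?thesis
      by (metis invertible_det_nz invertible_left_inverse matrix_left_invertible_ker)
  qed
  moreover have "continuous_on {0..1} (\<lambda>t. det (M t))"
    unfolding det_def M_def by (auto intro!: continuous_intros)
  moreover have "M 1 = gram B" "M 0 = mat 1"
    by (simp_all add: M_def mat_def vec_eq_iff)
  ultimately show False
    using IVT2'[of "\<lambda>t. det (M t)" 1 0 0] neg by (force simp: not_less)
qed

text \<open>The linear map taking the coordinate basis to the frame pulls \<open>h\<close> back to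
  the Euclidean inner product, whose Gram matrix is the identity.\<close>

lemma orthonormal_frame_det:
  fixes v :: "nat \<Rightarrow> real ^ 'n::{finite, linorder}"
  assumes "bilinear h" "orthonormal_frame h v"
  shows "(det (\<chi> i::'n. v (coord_rank i)))\<^sup>2 * det (gram h) = 1"
proof -
  define P where "P = (\<lambda>x. transpose (\<chi> i::'n. v (coord_rank i)) *v x)"
  have P: "linear P" unfolding P_def by (rule matrix_vector_mul_linear)
  have Pe: "P (axis i 1) = v (coord_rank i)" for i
    by (simp add: P_def matrix_vector_mult_basis column_def transpose_def vec_eq_iff)
  have "coord_rank i = coord_rank j \<longleftrightarrow> i = j" for i j :: 'n
    by (metis coord_at_rank)
  then have "h (P (axis i 1)) (P (axis j 1)) = (if i = j then 1 else 0)" for i j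
    using assms(2) unfolding Pe orthonormal_frame_def by simp
  then have "gram (\<lambda>u v. h (P u) (P v)) = mat 1"
    by (simp add: gram_def mat_def vec_eq_iff)
  moreover have "matrix P = transpose (\<chi> i::'n. v (coord_rank i))"
    unfolding P_def by (rule matrix_of_matrix_vector_mul)
  ultimately show ?thesis
    using det_gram_linear[OF assms(1) P] by (simp add: det_transpose det_I)
qed

text \<open>Comparing \<mu> with the determinant turns the Gram condition into (\<mu> v)^2 = 1;
  positivity selects the sign. This condition is the one that the factor s will be chosen to
  satisfy.\<close>

lemma top_form_orthonormal_frame:
  fixes \<mu> :: "'n::{finite, linorder} alt_form"
  assumes \<mu>: "alternating_form CARD('n) \<mu>" and pos: "\<And>v. positive_frame v \<Longrightarrow> \<mu> v > 0"
    and h: "bilinear h" "det (gram h) = (\<mu> standard_frame)\<^sup>2"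
    and v: "orthonormal_frame h v" "positive_frame v"
  shows "\<mu> v = 1"
proof -
  have "(\<mu> v)\<^sup>2 = 1"
    using orthonormal_frame_det[OF h(1) v(1)] h(2) top_form_eq_det[OF \<mu>, of v]
    by (simp add: power_mult_distrib)
  with pos[OF v(2)] show ?thesis by (simp add: power2_eq_1_iff)
qed

lemma det_matrix_rows:
  fixes v :: "'n::finite \<Rightarrow> real ^ 'n"
  assumes "linear P"
  shows "det (\<chi> i. P (v i)) = det (matrix P) * det (\<chi> i. v i)"
proof -
  have "(\<chi> i. P (v i)) = (\<chi> i. v i) ** transpose (matrix P)"
  proof -
    have "P (v i) $ j = (\<Sum>k\<in>UNIV. v i $ k * matrix P $ j $ k)" for i j
    proof -
      have "P (v i) = matrix P *v v i" using assms by (simp add: matrix_works)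
      then show ?thesis by (simp add: matrix_vector_mult_def mult.commute)
    qed
    then show ?thesis by (simp add: vec_eq_iff matrix_matrix_mult_def transpose_def)
  qed
  then show ?thesis by (simp add: det_mul det_transpose)
qed

section \<open>Inner products split along a vector and the kernel of a functional\<close>

definition kernel_proj :: "(real ^ 'n \<Rightarrow> real) \<Rightarrow> real ^ 'n \<Rightarrow> real ^ 'n \<Rightarrow> real ^ 'n" where
  "kernel_proj a x u = u - (a u / a x) *\<^sub>R x"

text \<open>The factor \<open>s\<close> adjusts the volume without changing the form dual to \<open>x\<close>.\<close>

definition split_form ::
  "(real ^ 'n \<Rightarrow> real) \<Rightarrow> real ^ 'n \<Rightarrow> (real ^ 'n \<Rightarrow> real ^ 'n \<Rightarrow> real) \<Rightarrow> real \<Rightarrow>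
    real ^ 'n \<Rightarrow> real ^ 'n \<Rightarrow> real" where
  "split_form a x h s u v = a u * a v / a x + s * h (kernel_proj a x u) (kernel_proj a x v)"

context
  fixes a :: "real ^ 'n::finite \<Rightarrow> real" and x :: "real ^ 'n" and h :: "real ^ 'n \<Rightarrow> real ^ 'n \<Rightarrow> real"
  assumes a: "linear a" and ax: "a x > 0" and h: "bilinear h" "\<And>u. u \<noteq> 0 \<Longrightarrow> h u u > 0"
begin

lemma linear_kernel_proj: "linear (kernel_proj a x)"
  using a by (simp add: linear_iff kernel_proj_def algebra_simps add_divide_distrib)

lemma kernel_proj_self: "kernel_proj a x x = 0"
  using ax by (simp add: kernel_proj_def)

lemma functional_kernel_proj: "a (kernel_proj a x u) = 0"
  using ax a by (simp add: kernel_proj_def linear_diff linear_scale)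

lemma bilinear_split_form: "bilinear (split_form a x h s)"
proof -
  note l = linear_add[OF linear_kernel_proj] linear_scale[OF linear_kernel_proj] linear_add[OF a] linear_scale[OF a]
    bilinear_ladd[OF h(1)] bilinear_radd[OF h(1)] bilinear_lmul[OF h(1)] bilinear_rmul[OF h(1)]
  show ?thesis
    unfolding bilinear_def
    by (auto intro!: linearI simp: split_form_def l algebra_simps add_divide_distrib)
qed

lemma split_form_pos:
  assumes "s > 0" "u \<noteq> 0" shows "split_form a x h s u u > 0"
proof (cases "a u = 0")
  case True
  then show ?thesis using assms h(2)[of u] by (simp add: split_form_def kernel_proj_def)
next
  case False
  have "h w w \<ge> 0" for w
    using h(2)[of w] bilinear_lzero[OF h(1), of w] by (cases "w = 0") auto
  moreover have "a u * a u / a x > 0" using False ax by (intro divide_pos_pos) (auto simp: zero_less_mult_iff neq_iff)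
  ultimately show ?thesis using assms by (simp add: split_form_def add_pos_nonneg)
qed

lemma split_form_dual: "split_form a x h s x v = a v"
  using ax bilinear_lzero[OF h(1)] by (simp add: split_form_def kernel_proj_self)

text \<open>
  \<open>split_form a x h s\<close> is the pullback of \<open>split_form a x h 1\<close> under the map fixing \<open>x\<close> and acting
  as the scalar \<open>sqrt s\<close> on the kernel of \<open>a\<close>.
\<close>

lemma det_gram_split_form:
  assumes s: "s > 0"
  shows "det (gram (split_form a x h s)) = s ^ (CARD('n) - 1) * det (gram (split_form a x h 1))"
proof -
  define T where "T u = (a u / a x) *\<^sub>R x + sqrt s *\<^sub>R kernel_proj a x u" for u
  note lin = linear_add[OF linear_kernel_proj] linear_scale[OF linear_kernel_proj] linear_add[OF a] linear_scale[OF a]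
  have T: "linear T"
    by (rule linearI) (simp_all add: T_def lin algebra_simps add_divide_distrib)
  have proj_ker: "kernel_proj a x w = w" if "a w = 0" for w
    using that by (simp add: kernel_proj_def)
  have aT: "a (T u) = a u" for u
    using ax by (simp add: T_def lin functional_kernel_proj)
  have pT: "kernel_proj a x (T u) = sqrt s *\<^sub>R kernel_proj a x u" for u
    by (simp add: T_def lin kernel_proj_self proj_ker functional_kernel_proj)
  have Tx: "T x = x" using ax by (simp add: T_def kernel_proj_self)
  have Tp: "T (kernel_proj a x u) = sqrt s *\<^sub>R kernel_proj a x u" for u
    by (simp add: T_def proj_ker functional_kernel_proj)
  have "split_form a x h s u v = split_form a x h 1 (T u) (T v)" for u v
    using s by (simp add: split_form_def aT pT bilinear_lmul[OF h(1)] bilinear_rmul[OF h(1)])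
  then have "split_form a x h s = (\<lambda>u v. split_form a x h 1 (T u) (T v))"
    by (simp add: fun_eq_iff)
  then have det_s: "det (gram (split_form a x h s)) = (det (matrix T))\<^sup>2 * det (gram (split_form a x h 1))"
    using det_gram_linear[OF bilinear_split_form T] by simp
  have "x \<noteq> 0" using ax linear_0[OF a] by auto
  then obtain k where k: "x $ k \<noteq> 0" by (auto simp: vec_eq_iff)
  \<comment> \<open>An eigenbasis of \<open>T\<close>: \<open>x\<close> has eigenvalue 1, and the
    projections of the other axis vectors have eigenvalue \<open>sqrt s\<close>. Replacing an axis
    vector along which \<open>x\<close> has a nonzero component keeps the family
    independent.\<close>
  define b where "b i = (if i = k then x else kernel_proj a x (axis i 1))" for i
  have "y = 0" if "(\<chi> i. b i) *v y = 0" for y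
  proof -
    have b0: "b i \<bullet> y = 0" for i
      using that by (simp add: vec_eq_iff matrix_vector_mult_def inner_vec_def)
    have xy: "x \<bullet> y = 0" using b0[of k] by (simp add: b_def)
    \<comment> \<open>Since \<open>y\<close> is orthogonal to \<open>x\<close>, the correction term
      of the projection drops out and only the coordinate remains.\<close>
    have y: "y $ i = 0" if "i \<noteq> k" for i
      using b0[of i] that xy by (simp add: b_def kernel_proj_def inner_diff_left inner_axis')
    have "x \<bullet> y = x $ k * y $ k"
      using y by (subst inner_vec_def) (simp add: sum.remove[of UNIV k])
    then have "y $ k = 0" using xy k by simp
    then show ?thesis using y by (metis vec_eq_iff zero_index)
  qed
  then have "invertible (\<chi> i. b i)"
    by (metis invertible_left_inverse matrix_left_invertible_ker)
  then have det_b: "det (\<chi> i. b i) \<noteq> 0" by (simp add: invertible_det_nz)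
  define D where "D = (\<chi> i j. if i = j then (if i = k then 1 else sqrt s) else 0 :: real ^ 'n ^ 'n)"
  have "(\<chi> i. T (b i)) = D ** (\<chi> i. b i)"
  proof -
    have "(\<Sum>l\<in>UNIV. D $ i $ l * b l $ j) = (if i = k then 1 else sqrt s) * b i $ j" for i j
      by (simp add: D_def if_distrib[of "\<lambda>c. c * _"] cong: if_cong)
    then show ?thesis by (simp add: vec_eq_iff matrix_matrix_mult_def b_def Tx Tp)
  qed
  \<comment> \<open>Both sides multiply the nonzero determinant of the eigenbasis, which
    cancels.\<close>
  then have "det (matrix T) = det D"
    using det_matrix_rows[OF T, of b] det_b by (simp add: det_mul)
  also have "\<dots> = (\<Prod>i\<in>UNIV. if i = k then 1 else sqrt s)"
    by (subst det_diagonal) (simp_all add: D_def)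
  also have "\<dots> = sqrt s ^ (CARD('n) - 1)"
    by (subst prod.remove[of _ k]) (simp_all add: card_Diff_singleton)
  finally have "(det (matrix T))\<^sup>2 = (sqrt s ^ 2) ^ (CARD('n) - 1)"
    by (simp only: power_mult[symmetric] mult.commute)
  then show ?thesis using det_s s by simp
qed

end

section \<open>Metrics adapted to a vector field\<close>

lemma alternating_form_mult_left:
  assumes "alternating_form k \<omega>"
  shows "alternating_form k (\<lambda>v. c * \<omega> v)"
  unfolding alternating_form_def
proof (intro conjI allI impI)
  show "c * \<omega> v = c * \<omega> w" if "\<forall>i<k. v i = w i" for v w
    using alternating_form_cong[OF assms, of v w] that by simp
  show "linear (\<lambda>u. c * \<omega> (v(i := u)))" if "i < k" for v i
    using linear_compose_scale_right[OF alternating_form_linear[OF assms that]] by simp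
  show "c * \<omega> v = 0" if "i < k" "j < k" "i \<noteq> j \<and> v i = v j" for v i j
    using alternating_form_eq_0[OF assms that(1,2)] that(3) by simp
qed

lemma alternating_form_det:
  "alternating_form CARD('n) (\<lambda>v. det (\<chi> i::'n::{finite, linorder}. v (coord_rank i)))"
  unfolding alternating_form_def
proof (intro conjI allI impI)
  fix v w :: "nat \<Rightarrow> real ^ 'n::{finite, linorder}" assume "\<forall>i<CARD('n). v i = w i"
  then show "det (\<chi> i::'n. v (coord_rank i)) = det (\<chi> i::'n. w (coord_rank i))" by simp
next
  fix v :: "nat \<Rightarrow> real ^ 'n::{finite, linorder}" and j assume j: "j < CARD('n)"
  have "coord_rank i = j \<longleftrightarrow> i = coord_at j" for i :: 'n
    using j by (metis coord_at_rank coord_rank_at)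
  then have eq: "(\<chi> i::'n. (v(j := u)) (coord_rank i)) = (\<chi> i. if i = coord_at j then u else v (coord_rank i))" for u
    by (simp add: vec_eq_iff)
  show "linear (\<lambda>u. det (\<chi> i::'n. (v(j := u)) (coord_rank i)))"
    unfolding eq
  proof (rule linearI)
    show "det (\<chi> i. if i = coord_at j then c *\<^sub>R u else v (coord_rank i)) =
        c *\<^sub>R det (\<chi> i::'n. if i = coord_at j then u else v (coord_rank i))" for c :: real and u
      using det_row_mul[of "coord_at j" c "\<lambda>_. u" "\<lambda>i::'n. v (coord_rank i)"]
      unfolding scalar_mult_eq_scaleR by simp
  qed (simp add: det_row_add)
next
  fix v :: "nat \<Rightarrow> real ^ 'n::{finite, linorder}" and i j
  assume ij: "i < CARD('n)" "j < CARD('n)" "i \<noteq> j \<and> v i = v j"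
  then have "coord_at i \<noteq> (coord_at j :: 'n)" by (metis coord_rank_at)
  then show "det (\<chi> i::'n. v (coord_rank i)) = 0"
    by (rule det_identical_rows) (use ij in \<open>simp add: row_def vec_eq_iff\<close>)
qed

context oriented_manifold
begin

lemma det_matrix_from_chart: "c \<in> A \<Longrightarrow> p \<in> fst c \<Longrightarrow> det (matrix (from_chart A c p)) > 0"
  by (simp add: from_chart_eq det_trans_deriv)

lemma vector_field_scaleR:
  assumes "vector_field A X" "smooth_function A f"
  shows "vector_field A (\<lambda>p. f p *\<^sub>R X p)"
  unfolding vector_field_def
proof
  fix c assume c: "c \<in> A"
  have "smooth_on (chart_image c) (\<lambda>x. f (chart_inv c x) *\<^sub>R local_vector_field A c X x)"
    using assms c by (intro smooth_on_scaleR chart_image_open smooth_functionD vector_field_local)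
  then show "smooth_on (chart_image c) (local_vector_field A c (\<lambda>p. f p *\<^sub>R X p))"
    by (rule smooth_on_cong[OF chart_image_open[OF c]])
      (use c in \<open>simp add: local_vector_field_def linear_scale[OF linear_to_chart]\<close>)
qed

text \<open>Smoothness of a metric is defined on constant coordinate vectors; bilinearity extends it
  to smooth vectors, one argument at a time.\<close>

lemma smooth_on_metric:
  assumes g: "riemannian_metric A g" and c: "c \<in> A"
    and uw: "smooth_on (chart_image c) u" "smooth_on (chart_image c) w"
  shows "smooth_on (chart_image c)
    (\<lambda>x. g (chart_inv c x) (from_chart A c (chart_inv c x) (u x)) (from_chart A c (chart_inv c x) (w x)))"
proof -
  define L where "L x a b = g (chart_inv c x) (from_chart A c (chart_inv c x) a) (from_chart A c (chart_inv c x) b)"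
    for x a b
  have B: "bilinear (g p)" for p using g by (simp add: riemannian_metric_def)
  have S: "smooth_on (chart_image c) (\<lambda>x. L x a b)" for a b
    using g c by (simp add: riemannian_metric_def L_def)
  have J: "linear (from_chart A c (chart_inv c x))" if "x \<in> chart_image c" for x
    using linear_from_chart c that by simp
  have 1: "linear (\<lambda>a. L x a b)" if "x \<in> chart_image c" for x b
    unfolding L_def using linear_compose[OF J[OF that], of "\<lambda>a. g (chart_inv c x) a _"] B
    by (simp add: bilinear_def o_def)
  have 2: "linear (L x a)" if "x \<in> chart_image c" for x a
  proof -
    have "L x a = (\<lambda>b. g (chart_inv c x) (from_chart A c (chart_inv c x) a) (from_chart A c (chart_inv c x) b))"
      by (simp add: L_def fun_eq_iff)
    then show ?thesis using linear_compose[OF J[OF that], of "\<lambda>b. g (chart_inv c x) _ b"] B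
      by (simp add: bilinear_def o_def)
  qed
  have 3: "smooth_on (chart_image c) (\<lambda>x. L x (u x) b)" for b
    by (rule smooth_on_linear_apply[OF chart_image_open[OF c] uw(1), where L="\<lambda>x a. L x a b"]) (fact 1 S)+
  have "smooth_on (chart_image c) (\<lambda>x. L x (u x) (w x))"
    by (rule smooth_on_linear_apply[OF chart_image_open[OF c] uw(2), where L="\<lambda>x. L x (u x)"]) (fact 2 3)+
  then show ?thesis by (simp add: L_def)
qed

lemma det_gram_local:
  assumes "riemannian_metric A g" "c \<in> A" "x \<in> chart_image c"
  shows "det (gram (\<lambda>u v. g (chart_inv c x) (from_chart A c (chart_inv c x) u) (from_chart A c (chart_inv c x) v))) =
    (det (matrix (from_chart A c (chart_inv c x))))\<^sup>2 * det (gram (g (chart_inv c x)))"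
  using assms by (intro det_gram_linear linear_from_chart) (auto simp: riemannian_metric_def)

lemma smooth_on_det_gram:
  assumes "riemannian_metric A g" "c \<in> A"
  shows "smooth_on (chart_image c)
    (\<lambda>x. det (gram (\<lambda>u v. g (chart_inv c x) (from_chart A c (chart_inv c x) u) (from_chart A c (chart_inv c x) v))))"
  using smooth_on_metric[OF assms smooth_on_const smooth_on_const] assms(2)
  by (intro smooth_on_det chart_image_open) (simp_all add: gram_def)

lemma det_gram_metric_pos: "riemannian_metric A g \<Longrightarrow> det (gram (g p)) > 0"
  by (intro det_gram_pos) (auto simp: riemannian_metric_def)

lemma top_form_local:
  assumes "diff_form A CARD('n) \<omega>" "c \<in> A" "x \<in> chart_image c"
  shows "local_form A c \<omega> x standard_frame =
    det (matrix (from_chart A c (chart_inv c x))) * \<omega> (chart_inv c x) standard_frame"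
proof -
  have "local_form A c \<omega> x standard_frame =
      det (\<chi> i::'n. from_chart A c (chart_inv c x) (standard_frame (coord_rank i))) * \<omega> (chart_inv c x) standard_frame"
    unfolding local_form_def using top_form_eq_det[OF diff_form_alternating[OF assms(1)]] by blast
  then show ?thesis
    using det_matrix_rows[OF linear_from_chart[OF assms(2) chart_inv_in[OF assms(2,3)]],
        of "\<lambda>i. standard_frame (coord_rank i)"] by simp
qed

lemma volume_form_pos: "volume_form A \<mu> \<Longrightarrow> \<mu> p standard_frame > 0"
  by (simp add: volume_form_def positive_frame_def)

text \<open>The Riemannian volume form of an arbitrary metric. The Gram determinant in a fixed chart
  is smooth and carries the squared Jacobian; as the atlas is oriented, its root carries the
  Jacobian itself, which is the transformation rule of a top-degree form.\<close>

lemma volume_form_exists: "\<exists>\<mu>. volume_form A \<mu>"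
proof -
  obtain h where h: "riemannian_metric A h" using riemannian_metric_exists by blast
  define \<mu> where "\<mu> p v = sqrt (det (gram (h p))) * det (\<chi> i::'n. v (coord_rank i))" for p v
  have alt: "alternating_form CARD('n) (\<mu> p)" for p
    unfolding \<mu>_def by (rule alternating_form_mult_left[OF alternating_form_det])
  have "smooth_on (chart_image c) (\<lambda>x. local_form A c \<mu> x v)" if c: "c \<in> A" for c v
  proof -
    define M where "M x = det (gram (\<lambda>u v. h (chart_inv c x) (from_chart A c (chart_inv c x) u) (from_chart A c (chart_inv c x) v)))" for x
    have J: "det (matrix (from_chart A c (chart_inv c x))) > 0" if "x \<in> chart_image c" for x
      using det_matrix_from_chart c that by simp
    have M_eq: "M x = (det (matrix (from_chart A c (chart_inv c x))))\<^sup>2 * det (gram (h (chart_inv c x)))"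
      if "x \<in> chart_image c" for x
      unfolding M_def by (rule det_gram_local[OF h c that])
    have M_pos: "M x > 0" if "x \<in> chart_image c" for x
      unfolding M_eq[OF that] using J[OF that] det_gram_metric_pos[OF h] by simp
    have "smooth_on (chart_image c) (\<lambda>x. M x powr (1 / 2) * det (\<chi> i::'n. v (coord_rank i)))"
      unfolding M_def
      by (intro smooth_on_mult smooth_on_powr_compose smooth_on_const chart_image_open smooth_on_det_gram h c)
        (use M_pos in \<open>simp add: M_def\<close>)
    then show ?thesis
    proof (rule smooth_on_cong[OF chart_image_open[OF c]])
      fix x assume x: "x \<in> chart_image c"
      have "M x powr (1 / 2) = det (matrix (from_chart A c (chart_inv c x))) * sqrt (det (gram (h (chart_inv c x))))"
        using M_pos[OF x] J[OF x] by (simp add: powr_half_sqrt M_eq[OF x] real_sqrt_mult)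
      then show "M x powr (1 / 2) * det (\<chi> i::'n. v (coord_rank i)) = local_form A c \<mu> x v"
        using det_matrix_rows[OF linear_from_chart[OF c chart_inv_in[OF c x]], of "\<lambda>i. v (coord_rank i)"]
        by (simp add: local_form_def \<mu>_def)
    qed
  qed
  moreover have "\<mu> p v > 0" if "positive_frame v" for p v
    using that det_gram_metric_pos[OF h] by (simp add: \<mu>_def positive_frame_def)
  ultimately have "volume_form A \<mu>"
    using alt by (simp add: volume_form_def diff_form_def)
  then show ?thesis by (rule exI[of _ \<mu>])
qed

lemma diff_form_metric_dual:
  assumes g: "riemannian_metric A g" and X: "vector_field A X"
  shows "diff_form A 1 (metric_dual g X)"
  unfolding diff_form_def
proof (intro conjI allI ballI)
  fix p
  have "linear (g p (X p))" using g by (simp add: riemannian_metric_def bilinear_def)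
  then show "alternating_form 1 (metric_dual g X p)"
    by (simp add: alternating_form_def metric_dual_def)
next
  fix c v assume c: "c \<in> A"
  show "smooth_on (chart_image c) (\<lambda>x. local_form A c (metric_dual g X) x v)"
    by (rule smooth_on_cong[OF chart_image_open[OF c]
          smooth_on_metric[OF g c vector_field_local[OF X c] smooth_on_const[of _ "v 0"]]])
      (simp add: local_form_def metric_dual_def from_chart_local_vector_field c)
qed

text \<open>Pointwise properties are linear algebra. For smoothness the projection is formed in the
  coordinates of a fixed chart, where \<alpha> and X are smooth, and then carried over by the linear
  map \<open>from_chart\<close>.\<close>

lemma riemannian_metric_split_form:
  assumes \<alpha>: "diff_form A 1 \<alpha>" and X: "vector_field A X" and pos: "\<And>p. \<alpha> p (\<lambda>_. X p) > 0"
    and h: "riemannian_metric A h" and s: "smooth_function A s" "\<And>p. s p > 0"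
  shows "riemannian_metric A (\<lambda>p. split_form (\<lambda>u. \<alpha> p (\<lambda>_. u)) (X p) (h p) (s p))"
    (is "riemannian_metric A ?g")
proof -
  have hp: "bilinear (h p)" "\<And>u. u \<noteq> 0 \<Longrightarrow> h p u u > 0" "h p u v = h p v u" for p u v
    using h by (auto simp: riemannian_metric_def)
  have "smooth_on (chart_image c)
      (\<lambda>x. ?g (chart_inv c x) (from_chart A c (chart_inv c x) u) (from_chart A c (chart_inv c x) v))"
    if c: "c \<in> A" for c u v
  proof -
    define a where "a x u = local_form A c \<alpha> x (\<lambda>_. u)" for x u
    define Y where "Y = local_vector_field A c X"
    define P where "P x u = u - (a x u / a x (Y x)) *\<^sub>R Y x" for x u
    note o = chart_image_open[OF c]
    have Y: "smooth_on (chart_image c) Y" unfolding Y_def by (rule vector_field_local[OF X c])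
    have a: "smooth_on (chart_image c) (\<lambda>x. a x u)" for u
      unfolding a_def by (rule diff_form_smooth[OF \<alpha> c])
    have a_lin: "linear (a x)" if "x \<in> chart_image c" for x
    proof -
      have "a x = (\<lambda>u. local_form A c \<alpha> x (\<lambda>_. u))" by (simp add: a_def fun_eq_iff)
      then show ?thesis using linear_local_one_form[OF \<alpha> c that] by simp
    qed
    have aY: "smooth_on (chart_image c) (\<lambda>x. a x (Y x))"
      by (rule smooth_on_linear_apply[OF o Y a_lin a])
    have a_eq: "a x u = \<alpha> (chart_inv c x) (\<lambda>_. from_chart A c (chart_inv c x) u)" for x u
      by (simp add: a_def local_form_def)
    have XY: "from_chart A c (chart_inv c x) (Y x) = X (chart_inv c x)" if "x \<in> chart_image c" for x
      unfolding Y_def by (rule from_chart_local_vector_field[OF c that])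
    have aY_pos: "a x (Y x) > 0" if "x \<in> chart_image c" for x
      using pos by (simp add: a_eq XY[OF that])
    have P: "smooth_on (chart_image c) (\<lambda>x. P x u)" for u
      unfolding P_def by (intro smooth_on_diff smooth_on_const smooth_on_scaleR smooth_on_divide o a aY Y aY_pos)
    have sm: "smooth_on (chart_image c) (\<lambda>x. s (chart_inv c x))" by (rule smooth_functionD[OF s(1) c])
    have "smooth_on (chart_image c) (\<lambda>x. a x u * a x v / a x (Y x) + s (chart_inv c x) *
        h (chart_inv c x) (from_chart A c (chart_inv c x) (P x u)) (from_chart A c (chart_inv c x) (P x v)))"
      by (intro smooth_on_add smooth_on_divide smooth_on_mult o a aY aY_pos sm smooth_on_metric[OF h c] P)
    then show ?thesis
    proof (rule smooth_on_cong[OF o])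
      fix x assume x: "x \<in> chart_image c"
      let ?J = "from_chart A c (chart_inv c x)"
      have J: "linear ?J" by (rule linear_from_chart[OF c chart_inv_in[OF c x]])
      have "?J (P x w) = kernel_proj (\<lambda>u. \<alpha> (chart_inv c x) (\<lambda>_. u)) (X (chart_inv c x)) (?J w)" for w
        by (simp add: P_def kernel_proj_def linear_diff[OF J] linear_scale[OF J] XY[OF x] a_eq)
      then show "a x u * a x v / a x (Y x) + s (chart_inv c x) * h (chart_inv c x) (?J (P x u)) (?J (P x v)) =
          ?g (chart_inv c x) (?J u) (?J v)"
        by (simp add: split_form_def a_eq XY[OF x])
    qed
  qed
  moreover have "bilinear (?g p)" for p
    by (rule bilinear_split_form[OF linear_one_form[OF \<alpha>] pos hp(1,2)])
  moreover have "?g p u u > 0" if "u \<noteq> 0" for p u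
    by (rule split_form_pos[OF linear_one_form[OF \<alpha>] pos hp(1,2) s(2) that])
  moreover have "?g p u v = ?g p v u" for p u v
    unfolding split_form_def using hp(3) by (simp add: mult.commute)
  ultimately show ?thesis unfolding riemannian_metric_def by blast
qed

lemma metric_with_dual_and_volume:
  assumes \<alpha>: "diff_form A 1 \<alpha>" and X: "vector_field A X" and pos: "\<And>p. \<alpha> p (\<lambda>_. X p) > 0"
    and \<mu>: "volume_form A \<mu>" and n: "CARD('n) = 2 * n + 1" "n > 0"
  shows "\<exists>g. riemannian_metric A g \<and> metric_dual g X = \<alpha> \<and> riemannian_volume_form A g \<mu>"
proof -
  obtain h where h: "riemannian_metric A h" using riemannian_metric_exists by blast
  have hp: "bilinear (h p)" "\<And>u. u \<noteq> 0 \<Longrightarrow> h p u u > 0" for p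
    using h by (auto simp: riemannian_metric_def)
  define G where "G t p = split_form (\<lambda>u. \<alpha> p (\<lambda>_. u)) (X p) (h p) t" for t :: real and p
  have "riemannian_metric A (\<lambda>p. split_form (\<lambda>u. \<alpha> p (\<lambda>_. u)) (X p) (h p) 1)"
    by (rule riemannian_metric_split_form[OF \<alpha> X pos h]) (auto intro!: smooth_functionI smooth_on_const)
  then have G1: "riemannian_metric A (G 1)" by (simp add: G_def[abs_def])
  have \<mu>d: "diff_form A CARD('n) \<mu>" using \<mu> by (simp add: volume_form_def)
  \<comment> \<open>The squared ratio of \<mu> to the volume form of \<open>G 1\<close>. The Gram
    determinant of \<open>G (s p) p\<close> is s^(2n) times that of \<open>G 1 p\<close>, so s has
    to be the 2n-th root of \<open>r\<close>, which is where n > 0 enters.\<close>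
  define r where "r p = (\<mu> p standard_frame)\<^sup>2 / det (gram (G 1 p))" for p
  define s where "s p = r p powr (1 / (2 * real n))" for p
  have r_pos: "r p > 0" for p
    using det_gram_metric_pos[OF G1] volume_form_pos[OF \<mu>, of p] by (simp add: r_def)
  have s_pos: "s p > 0" for p using r_pos[of p] by (simp add: s_def)
  have "smooth_function A s"
  proof (rule smooth_functionI)
    fix c assume c: "c \<in> A"
    note o = chart_image_open[OF c]
    let ?M = "\<lambda>x. det (gram (\<lambda>u v. G 1 (chart_inv c x) (from_chart A c (chart_inv c x) u) (from_chart A c (chart_inv c x) v)))"
    let ?m = "\<lambda>x. local_form A c \<mu> x standard_frame"
    have J: "det (matrix (from_chart A c (chart_inv c x))) > 0" if "x \<in> chart_image c" for x
      using det_matrix_from_chart c that by simp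
    have M: "?M x > 0" if "x \<in> chart_image c" for x
      unfolding det_gram_local[OF G1 c that] using J[OF that] det_gram_metric_pos[OF G1] by simp
    \<comment> \<open>Numerator and denominator both acquire the squared Jacobian, so
      \<open>r\<close> may be computed in any chart although it is defined by components in
      \<open>chart_at\<close>.\<close>
    have eq: "r (chart_inv c x) = ?m x * ?m x / ?M x" if "x \<in> chart_image c" for x
      unfolding det_gram_local[OF G1 c that] top_form_local[OF \<mu>d c that] r_def
      using J[OF that] by (simp add: power2_eq_square)
    have sm: "smooth_on (chart_image c) ?m" by (rule diff_form_smooth[OF \<mu>d c])
    have "smooth_on (chart_image c) (\<lambda>x. ?m x * ?m x / ?M x)"
      by (intro smooth_on_divide smooth_on_mult o sm smooth_on_det_gram[OF G1 c] M)
    then have "smooth_on (chart_image c) (\<lambda>x. r (chart_inv c x))"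
      by (rule smooth_on_cong[OF o]) (simp add: eq)
    then show "smooth_on (chart_image c) (\<lambda>x. s (chart_inv c x))"
      unfolding s_def by (rule smooth_on_powr_compose[OF o _ r_pos])
  qed
  from riemannian_metric_split_form[OF \<alpha> X pos h this s_pos]
  have g: "riemannian_metric A (\<lambda>p. G (s p) p)" by (simp add: G_def)
  have "metric_dual (\<lambda>p. G (s p) p) X = \<alpha>"
  proof (intro ext)
    fix p v
    have "metric_dual (\<lambda>p. G (s p) p) X p v = \<alpha> p (\<lambda>_. v 0)"
      unfolding metric_dual_def G_def by (rule split_form_dual[OF linear_one_form[OF \<alpha>] pos hp])
    then show "metric_dual (\<lambda>p. G (s p) p) X p v = \<alpha> p v"
      using one_form_eq[OF \<alpha>] by simp
  qed
  moreover have "riemannian_volume_form A (\<lambda>p. G (s p) p) \<mu>"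
    unfolding riemannian_volume_form_def
  proof (intro conjI allI impI \<mu>d)
    fix p v assume v: "orthonormal_frame (G (s p) p) v \<and> positive_frame v"
    have "det (gram (G (s p) p)) = s p ^ (2 * n) * det (gram (G 1 p))"
      using det_gram_split_form[OF linear_one_form[OF \<alpha>] pos hp s_pos] n by (simp add: G_def)
    also have "s p ^ (2 * n) = r p"
      using r_pos[of p] n(2) by (simp add: s_def powr_realpow[symmetric] powr_powr)
    finally have "det (gram (G (s p) p)) = (\<mu> p standard_frame)\<^sup>2"
      using det_gram_metric_pos[OF G1, of p] by (simp add: r_def)
    then show "\<mu> p v = 1"
      using v g \<mu> by (intro top_form_orthonormal_frame[of "\<mu> p" "G (s p) p"] diff_form_alternating \<mu>d)
        (auto simp: riemannian_metric_def volume_form_def)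
  qed
  ultimately show ?thesis using g by (intro exI[of _ "\<lambda>p. G (s p) p"]) simp
qed

section \<open>Beltrami fields and adapted one-forms\<close>

text \<open>The metric enters through its volume form and the one-form dual to X, so the lemma
  serves both the split metric and the metric used in dimension one.\<close>

lemma beltrami_of_adapted:
  assumes \<alpha>: "adapted_one_form A n X \<alpha>" and X: "vector_field A X" and n: "CARD('n) = 2 * n + 1"
    and \<mu>: "volume_form A \<mu>" "riemannian_volume_form A g \<mu>" and dual: "metric_dual g X = \<alpha>"
  shows "beltrami A n g X"
proof -
  define \<omega> where "\<omega> p = wedge_power 2 (ext_deriv A 1 \<alpha> p) n" for p
  define \<tau> where "\<tau> p = wedge 1 (2 * n) (\<alpha> p) (\<omega> p)" for p
  \<comment> \<open>The ratio of \<tau> to \<mu> is read off on \<open>standard_frame\<close>. Both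
    values change by the same Jacobian between charts, so \<open>f\<close> is smooth.\<close>
  define f where "f p = \<tau> p standard_frame / (\<alpha> p (\<lambda>_. X p) * \<mu> p standard_frame)" for p
  have \<alpha>d: "diff_form A 1 \<alpha>" and pos: "\<alpha> p (\<lambda>_. X p) > 0" and con: "contract (2 * n) (X p) (\<omega> p) v = 0" for p v
    using \<alpha> by (auto simp: adapted_one_form_def \<omega>_def)
  have \<mu>d: "diff_form A CARD('n) \<mu>" using \<mu> by (simp add: volume_form_def)
  have \<omega>d: "diff_form A (2 * n) \<omega>"
    using diff_form_wedge_power[OF diff_form_ext_deriv[OF \<alpha>d]] unfolding \<omega>_def[abs_def] .
  have \<tau>d: "diff_form A CARD('n) \<tau>"
    using diff_form_wedge[OF \<alpha>d \<omega>d] n unfolding \<tau>_def[abs_def] by (simp add: add.commute)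
  have f_smooth: "smooth_function A f"
  proof (rule smooth_functionI)
    fix c assume c: "c \<in> A"
    note o = chart_image_open[OF c]
    let ?a = "\<lambda>x. local_form A c \<alpha> x (\<lambda>_. local_vector_field A c X x)"
    let ?m = "\<lambda>x. local_form A c \<mu> x standard_frame"
    let ?t = "\<lambda>x. local_form A c \<tau> x standard_frame"
    have a: "smooth_on (chart_image c) ?a"
      by (rule smooth_on_linear_apply[OF o vector_field_local[OF X c], where L="\<lambda>x u. local_form A c \<alpha> x (\<lambda>_. u)"])
        (rule linear_local_one_form[OF \<alpha>d c] diff_form_smooth[OF \<alpha>d c], assumption?)+
    have a_eq: "?a x = \<alpha> (chart_inv c x) (\<lambda>_. X (chart_inv c x))" if "x \<in> chart_image c" for x
      using that c by (simp add: local_form_def from_chart_local_vector_field)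
    have J: "det (matrix (from_chart A c (chart_inv c x))) > 0" if "x \<in> chart_image c" for x
      using det_matrix_from_chart c that by simp
    have den: "?a x * ?m x > 0" if "x \<in> chart_image c" for x
      unfolding a_eq[OF that] top_form_local[OF \<mu>d c that]
      using pos J[OF that] volume_form_pos[OF \<mu>(1)] by simp
    have "smooth_on (chart_image c) (\<lambda>x. ?t x / (?a x * ?m x))"
      by (intro smooth_on_divide smooth_on_mult o a diff_form_smooth[OF \<mu>d c] diff_form_smooth[OF \<tau>d c] den)
    then show "smooth_on (chart_image c) (\<lambda>x. f (chart_inv c x))"
    proof (rule smooth_on_cong[OF o])
      fix x assume x: "x \<in> chart_image c"
      show "?t x / (?a x * ?m x) = f (chart_inv c x)"
        unfolding a_eq[OF x] top_form_local[OF \<mu>d c x] top_form_local[OF \<tau>d c x] f_def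
        using J[OF x] by simp
    qed
  qed
  have curl: "contract (2 * n + 1) (f p *\<^sub>R X p) (\<mu> p) v = \<omega> p v" for p v
  proof -
    have \<mu>p: "alternating_form CARD('n) (\<mu> p)" by (rule diff_form_alternating[OF \<mu>d])
    have "(case_nat (X p) v)(0 := u) = case_nat u v" for u
      by (auto simp: fun_eq_iff split: nat.split)
    then have "contract (2 * n + 1) (f p *\<^sub>R X p) (\<mu> p) v = f p * \<mu> p (case_nat (X p) v)"
      using alternating_form_scale[OF \<mu>p, of 0 "case_nat (X p) v" "f p" "X p"] n by (simp add: contract_def)
    moreover have "\<alpha> p (\<lambda>_. X p) * \<omega> p v * \<mu> p standard_frame = \<tau> p standard_frame * \<mu> p (case_nat (X p) v)"
      unfolding \<tau>_def
      by (rule horizontal_form_proportional[OF diff_form_alternating[OF \<omega>d] diff_form_alternating[OF \<alpha>d] con \<mu>p])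
        (simp add: n)
    then have "\<omega> p v = f p * \<mu> p (case_nat (X p) v)"
      using pos[of p] volume_form_pos[OF \<mu>(1), of p] by (simp add: f_def field_simps)
    ultimately show ?thesis by simp
  qed
  have "is_curl A n g X (\<lambda>p. f p *\<^sub>R X p)"
    unfolding is_curl_def dual
    using vector_field_scaleR[OF X f_smooth] \<mu>(2) curl by (auto simp: \<omega>_def fun_eq_iff intro!: exI[of _ \<mu>])
  then show ?thesis
    unfolding beltrami_def using X f_smooth by blast
qed

lemma adapted_of_beltrami:
  assumes g: "riemannian_metric A g" and b: "beltrami A n g X" and X: "\<And>p. X p \<noteq> 0" and n: "CARD('n) = 2 * n + 1"
  shows "adapted_one_form A n X (metric_dual g X)"
proof -
  obtain f \<mu> where \<mu>: "diff_form A CARD('n) \<mu>" and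
    eq: "\<And>p. contract (2 * n + 1) (f p *\<^sub>R X p) (\<mu> p) = wedge_power 2 (ext_deriv A 1 (metric_dual g X) p) n"
  proof -
    obtain Y f \<mu> where *: "riemannian_volume_form A g \<mu>"
      "\<And>p. contract (2 * n + 1) (Y p) (\<mu> p) = wedge_power 2 (ext_deriv A 1 (metric_dual g X) p) n"
      "\<And>p. Y p = f p *\<^sub>R X p"
      using b unfolding beltrami_def is_curl_def by blast
    then show ?thesis using that[of \<mu> f] by (simp add: riemannian_volume_form_def)
  qed
  \<comment> \<open>For n > 0, \<mu> receives X twice, in slot 0 from the curl and in slot 1 from
    the contraction. For n = 0 the contraction is that of a 0-form, zero by definition.\<close>
  have "contract (2 * n) (X p) (wedge_power 2 (ext_deriv A 1 (metric_dual g X) p) n) v = 0" for p v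
  proof (cases "n = 0")
    case False
    let ?w = "case_nat (X p) (case_nat (X p) v)"
    have \<mu>p: "alternating_form CARD('n) (\<mu> p)" by (rule diff_form_alternating[OF \<mu>])
    have w: "?w(0 := u) = case_nat u (case_nat (X p) v)" for u
      by (auto simp: fun_eq_iff split: nat.split)
    have "\<mu> p ?w = 0"
      by (rule alternating_form_eq_0[OF \<mu>p, of 0 1]) (use n False in auto)
    then have "\<mu> p (case_nat (f p *\<^sub>R X p) (case_nat (X p) v)) = 0"
      using alternating_form_scale[OF \<mu>p, of 0 ?w "f p" "X p"] n by (simp add: w)
    then show ?thesis unfolding eq[symmetric] by (simp add: contract_def)
  qed (simp add: contract_def)
  moreover have "vector_field A X" using b by (simp add: beltrami_def)
  ultimately show ?thesis
    using diff_form_metric_dual[OF g] g X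
    by (simp add: adapted_one_form_def metric_dual_def riemannian_metric_def)
qed

text \<open>On a line, \<mu> is a nonzero functional and its square is an inner product; a positive
  unit vector has \<mu> positive with square 1.\<close>

lemma one_dimensional_metric:
  assumes \<mu>: "volume_form A \<mu>" and n: "CARD('n) = 1"
  defines "g \<equiv> \<lambda>p u v. \<mu> p (\<lambda>_. u) * \<mu> p (\<lambda>_. v)"
  shows "riemannian_metric A g \<and> riemannian_volume_form A g \<mu>"
proof -
  have \<mu>d: "diff_form A 1 \<mu>" using \<mu> n by (simp add: volume_form_def)
  note lin = linear_add[OF linear_one_form[OF \<mu>d]] linear_scale[OF linear_one_form[OF \<mu>d]]
  have "bilinear (g p)" for p
    unfolding bilinear_def g_def by (auto intro!: linearI simp: lin algebra_simps)
  moreover have "g p u u > 0" if "u \<noteq> 0" for p u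
  proof -
    \<comment> \<open>With a single index the determinant is the only coordinate of
      \<open>u\<close>, so \<mu> vanishes on no nonzero vector.\<close>
    obtain k where k: "UNIV = {k :: 'n}" using n card_1_singletonE by metis
    have "i = j" for i j :: 'n using k by (metis UNIV_I singletonD)
    then have "det (\<chi> i::'n. u) = (\<Prod>i\<in>UNIV. u $ i)"
      by (subst det_diagonal) auto
    then have "det (\<chi> i::'n. u) = u $ k"
      by (simp add: k)
    moreover have "u $ k \<noteq> 0" using that k by (metis UNIV_I singletonD vec_eq_iff zero_index)
    ultimately have "\<mu> p (\<lambda>_. u) \<noteq> 0"
      using top_form_eq_det[of "\<mu> p" "\<lambda>_. u"] diff_form_alternating[OF \<mu>d] volume_form_pos[OF \<mu>, of p] n by simp
    then show ?thesis by (auto simp: g_def zero_less_mult_iff neq_iff)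
  qed
  moreover have "smooth_on (chart_image c)
      (\<lambda>x. g (chart_inv c x) (from_chart A c (chart_inv c x) u) (from_chart A c (chart_inv c x) v))" if "c \<in> A" for c u v
    using smooth_on_mult[OF chart_image_open[OF that] diff_form_smooth[OF \<mu>d that, of "\<lambda>_. u"]
        diff_form_smooth[OF \<mu>d that, of "\<lambda>_. v"]] by (simp add: g_def local_form_def)
  moreover have "g p u v = g p v u" for p u v by (simp add: g_def)
  ultimately have "riemannian_metric A g" unfolding riemannian_metric_def by blast
  moreover have "\<mu> p v = 1" if v: "orthonormal_frame (g p) v" "positive_frame v" for p v
  proof -
    have "g p (v 0) (v 0) = 1" using v(1) n by (simp add: orthonormal_frame_def)
    then have "(\<mu> p v)\<^sup>2 = 1" using one_form_eq[OF \<mu>d, of p v] by (simp add: g_def power2_eq_square)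
    moreover have "\<mu> p v > 0" using \<mu> v(2) by (simp add: volume_form_def)
    ultimately show ?thesis by (simp add: power2_eq_1_iff)
  qed
  ultimately show ?thesis using \<mu> by (simp add: riemannian_volume_form_def volume_form_def)
qed

text \<open>
  In dimension one every field is Beltrami, but a metric with \<open>g(X, \<cdot>) = \<alpha>\<close> need not have volume
  form \<open>\<mu>\<close>, so \<open>\<alpha>\<close> is replaced there.
\<close>

lemma beltrami_metric_exists:
  assumes \<alpha>: "adapted_one_form A n X \<alpha>" and X: "vector_field A X" "\<And>p. X p \<noteq> 0" and n: "CARD('n) = 2 * n + 1"
    and \<mu>: "volume_form A \<mu>"
  shows "\<exists>g. riemannian_metric A g \<and> beltrami A n g X \<and> riemannian_volume_form A g \<mu>"
proof (cases "n = 0")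
  case True
  define g where "g p u v = \<mu> p (\<lambda>_. u) * \<mu> p (\<lambda>_. v)" for p u v
  have g: "riemannian_metric A g" "riemannian_volume_form A g \<mu>"
    using one_dimensional_metric[OF \<mu>] n True by (simp_all add: g_def[abs_def])
  \<comment> \<open>The contraction condition concerns a 0-form here and holds trivially; positivity
    is that of g(X, X).\<close>
  have "adapted_one_form A n X (metric_dual g X)"
    using diff_form_metric_dual[OF g(1) X(1)] g(1) X(2) True
    by (simp add: adapted_one_form_def metric_dual_def riemannian_metric_def contract_def)
  then show ?thesis using beltrami_of_adapted[OF _ X(1) n \<mu> g(2)] g by blast
next
  case False
  then have "n > 0" by simp
  have \<alpha>d: "diff_form A 1 \<alpha>" and pos: "\<alpha> p (\<lambda>_. X p) > 0" for p
    using \<alpha> by (auto simp: adapted_one_form_def)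
  obtain g where "riemannian_metric A g" "metric_dual g X = \<alpha>" "riemannian_volume_form A g \<mu>"
    using metric_with_dual_and_volume[OF \<alpha>d X(1) pos \<mu> n \<open>n > 0\<close>] by blast
  then show ?thesis using beltrami_of_adapted[OF \<alpha> X(1) n \<mu>] by blast
qed

end

theorem lemma4p1:
  fixes A :: "('a::{t2_space, second_countable_topology}, 'n::{finite, linorder}) chart set"
    and X :: "'a \<Rightarrow> real ^ 'n::{finite, linorder}" and n :: nat
  assumes "oriented_atlas A" and "CARD('n) = 2 * n + 1"
    and "vector_field A X" and "\<And>p. X p \<noteq> 0"
  shows "((\<exists>g. riemannian_metric A g \<and> beltrami A n g X) \<longleftrightarrow> (\<exists>\<alpha>. adapted_one_form A n X \<alpha>)) \<and>
    (\<forall>\<alpha> \<mu>. adapted_one_form A n X \<alpha> \<and> volume_form A \<mu> \<and> preserves_volume A X \<mu> \<longrightarrow>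
      (\<exists>g. riemannian_metric A g \<and> beltrami A n g X \<and> riemannian_volume_form A g \<mu>))"
proof -
  interpret oriented_manifold A by unfold_locales (rule assms(1))
  \<comment> \<open>The equivalence prescribes no volume form, so an arbitrary one is fixed for the
    direction that constructs a metric.\<close>
  obtain \<mu>\<^sub>0 where \<mu>\<^sub>0: "volume_form A \<mu>\<^sub>0" using volume_form_exists by blast
  have "adapted_one_form A n X (metric_dual g X)" if "riemannian_metric A g" "beltrami A n g X" for g
    by (rule adapted_of_beltrami[OF that assms(4,2)])
  moreover have "\<exists>g. riemannian_metric A g \<and> beltrami A n g X \<and> riemannian_volume_form A g \<mu>"
    if "adapted_one_form A n X \<alpha>" "volume_form A \<mu>" for \<alpha> \<mu>
    by (rule beltrami_metric_exists[OF that(1) assms(3,4,2) that(2)])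
  ultimately show ?thesis using \<mu>\<^sub>0 by blast
qed

end
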